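(* Let $p$ be a prime number and let $F$ be a finite dimensional extension field of $\mathbb{Z}_p$, of vector space dimension $mn$, for some positive integers $m$ and $n$. Let $\alpha \in F\setminus\{0\}$ be such that the polynomial $x^{p}-x-\alpha$ is an irreducible Artin-Schreier polynomial over $F$, and such that $\alpha^{-1}$ is a normal element in $F$ over the subfield of $p^{m}$ elements, and also a normal element in $F$ over the prime field $\mathbb{Z}_p$. Let $\widehat{F} = F[\beta]/(\beta^{p}-\beta-\alpha)$. Then the element $\delta^{-1} = \beta^{-1}-1$ is a normal element in $\widehat{F}$ as an extension field of $F$, and also a normal element in $\widehat{F}$ as an extension field of the prime field $\mathbb{Z}_p$, and the polynomial $x^{p}-x-\delta$ is an irreducible Artin-Schreier polynomial over $\widehat{F}$. Moreover, the multiplication table of $\delta^{-1}$ is nearly optimal, with the inclusion of $1$ as an extra (redundant) element, if so needed.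
   Context: $\mathbb{Z}_p$ denotes the prime field of integers modulo $p$. In $\widehat{F} = F[\beta]/(\beta^{p}-\beta-\alpha)$, $\beta$ also denotes the residue class of the indeterminate, and $\delta$ is the inverse of $\beta^{-1}-1$. An Artin-Schreier polynomial over a field $K$ of characteristic $p$ is here a polynomial $x^{p}-x-a$ with $a\in K$. For finite fields $K \subseteq L$ with $|K| = q$ and $[L:K]=d$, an element $\theta\in L$ is a normal element in $L$ over $K$ if $\theta, \theta^{q}, \dots, \theta^{q^{d-1}}$ form a basis of $L$ over $K$. The multiplication table of $\delta^{-1}$ expresses the products of elements of the normal basis of $\widehat{F}$ over $F$ generated by $\delta^{-1}$. "Nearly optimal" is used informally: the optimality criterion is that the multiplication table have as few nonzero entries as possible, and near optimality refers to the fact that, except for the squares of basis elements, the product of two distinct basis elements is a linear combination of just those two elements (and of the extra element $1$, when it is included) with coefficients in a much smaller subfield. Concretely, writing $N=mn$ for the dimension of $F$ over $\mathbb{Z}_p$ and $h=\sum_{j=0}^{N-1}\alpha^{p^{j}}\in\mathbb{Z}_p\setminus\{0\}$, one has $\delta^{-(1+p^{iN})} = \left((ih)^{-1}-1\right)\delta^{-1}-\left((ih)^{-1}+1\right)\delta^{-p^{iN}}-1$ for $1\le i\le p-1$. *)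

theory Defs
  imports
    "HOL-Algebra.Polynomial_Divisibility"
    "HOL-Number_Theory.Residues"
begin

definition artin_schreier_poly :: "('a, 'b) ring_scheme \<Rightarrow> nat \<Rightarrow> 'a \<Rightarrow> 'a list"
  where "artin_schreier_poly R p a =
    (X\<^bsub>R\<^esub> [^]\<^bsub>poly_ring R\<^esub> p) \<ominus>\<^bsub>poly_ring R\<^esub> X\<^bsub>R\<^esub>
      \<ominus>\<^bsub>poly_ring R\<^esub> ring.poly_of_const R a"

definition artin_schreier_ext :: "('a, 'b) ring_scheme \<Rightarrow> nat \<Rightarrow> 'a \<Rightarrow> ('a list set) ring"
  where "artin_schreier_ext R p a = Rupt\<^bsub>R\<^esub> (carrier R) (artin_schreier_poly R p a)"

definition artin_schreier_root :: "('a, 'b) ring_scheme \<Rightarrow> nat \<Rightarrow> 'a \<Rightarrow> 'a list set"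
  where "artin_schreier_root R p a =
    ring.rupture_surj R (carrier R) (artin_schreier_poly R p a) X\<^bsub>R\<^esub>"

definition artin_schreier_embed :: "('a, 'b) ring_scheme \<Rightarrow> nat \<Rightarrow> 'a \<Rightarrow> 'a \<Rightarrow> 'a list set"
  where "artin_schreier_embed R p a c =
    ring.rupture_surj R (carrier R) (artin_schreier_poly R p a) (ring.poly_of_const R c)"

definition conjugates :: "('a, 'b) ring_scheme \<Rightarrow> 'a set \<Rightarrow> 'a \<Rightarrow> 'a list"
  where "conjugates L K \<theta> =
    map (\<lambda>i. \<theta> [^]\<^bsub>L\<^esub> (card K ^ i)) [0..<(ring.dim L over K) (carrier L)]"

definition normal_element :: "('a, 'b) ring_scheme \<Rightarrow> 'a set \<Rightarrow> 'a \<Rightarrow> bool"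
  where "normal_element L K \<theta> \<longleftrightarrow>
    field L \<and> finite (carrier L) \<and> subfield K L \<and> \<theta> \<in> carrier L \<and>
    ring.independent L K (conjugates L K \<theta>) \<and>
    ring.Span L K (conjugates L K \<theta>) = carrier L"

(* T i j lists the coefficients of Us ! i times Us ! j with respect to Us extended by 1.
   Since 1 may be redundant, a multiplication table of this kind need not be unique. *)
definition ext_mult_table ::
    "('a, 'b) ring_scheme \<Rightarrow> 'a set \<Rightarrow> 'a list \<Rightarrow> (nat \<Rightarrow> nat \<Rightarrow> 'a list) \<Rightarrow> bool"
  where "ext_mult_table L K Us T \<longleftrightarrow>
    (\<forall>i < length Us. \<forall>j < length Us.
       length (T i j) = Suc (length Us) \<and> set (T i j) \<subseteq> K \<and>
       Us ! i \<otimes>\<^bsub>L\<^esub> Us ! j = ring.combine L (T i j) (Us @ [\<one>\<^bsub>L\<^esub>]))"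

(* Index length Us is the position of the extra element 1; k is the smaller subfield. *)
definition nearly_optimal :: "('a, 'b) ring_scheme \<Rightarrow> 'a set \<Rightarrow> 'a set \<Rightarrow> 'a list \<Rightarrow> bool"
  where "nearly_optimal L K k Us \<longleftrightarrow>
    (\<exists>T. ext_mult_table L K Us T \<and>
      (\<forall>i < length Us. \<forall>j < length Us. i \<noteq> j \<longrightarrow>
         set (T i j) \<subseteq> k \<and>
         (\<forall>l < length Us. l \<noteq> i \<longrightarrow> l \<noteq> j \<longrightarrow> T i j ! l = \<zero>\<^bsub>L\<^esub>)))"

end

theory Submission
  imports Defs
begin

text \<open>
  Put \<open>N = mn\<close>, \<open>q = p\<^sup>N\<close> and let \<open>\<tau>\<close> be the image of \<open>h\<close>. Iterating \<open>\<beta>\<^sup>p = \<beta> + \<alpha>\<close> gives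
  \<open>\<beta>\<close> raised to \<open>q\<^sup>i\<close> equal to \<open>\<beta> + i\<tau>\<close>, so the conjugates of \<open>\<theta> = \<beta>\<inverse> - 1\<close> over \<open>F\<close> are
  \<open>1/(\<beta> + i\<tau>) - 1\<close>. For a polynomial \<open>x\<^sup>p - x - a\<close> over a finite field, irreducibility is
  equivalent to \<open>a\<close> having nonzero absolute trace: a root \<open>\<gamma>\<close> of an irreducible factor of degree
  \<open>d\<close> is fixed by the \<open>d\<close>-th power of the Frobenius map of the field, which sends it to
  \<open>\<gamma> + d tr(a)\<close>, whence \<open>p\<close> divides \<open>d\<close>.

  Let \<open>K\<close> be a subfield of \<open>F\<close> over which \<open>\<alpha>\<inverse>\<close> is normal; both \<open>K = F\<close> and the prime field
  qualify. The partial fraction identity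
  \<open>\<Sum>\<^sub>i (i\<tau>)\<^sup>d / (y + i\<tau>) = -(-y)\<^sup>d / (y\<^sup>p - y)\<close>, for \<open>d < p\<close>, applied to the \<open>K\<close>-conjugates
  \<open>y = \<beta> + a\<close> of \<open>\<beta>\<close> with \<open>a \<in> F\<close>, shows that the \<open>K\<close>-span of the conjugates of \<open>\<theta>\<close> contains all
  \<open>c (\<beta> + a)\<^sup>d\<close> where \<open>c\<close> runs through the conjugates of \<open>\<alpha>\<inverse>\<close>. Since these span \<open>F\<close>, induction
  on \<open>d\<close> puts \<open>F\<beta>\<^sup>d\<close> into the span, so the conjugates span the extension field, and they are independent
  because their number is its dimension. The case \<open>d = 0\<close> of the identity also shows that the
  trace of \<open>\<delta>\<close> down to \<open>F\<close> is \<open>\<alpha>\<inverse>\<close>, whose absolute trace is nonzero by normality.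
\<close>

section \<open>Power sums and partial fractions in characteristic \<open>p\<close>\<close>

lemma (in cring) add_pow_prod:
  fixes i j :: "nat"
  assumes "x \<in> carrier R" "y \<in> carrier R"
  shows "([i] \<cdot> x) \<otimes> ([j] \<cdot> y) = [(i * j)] \<cdot> (x \<otimes> y)"
  using assms by (simp add: add_pow_ldistr add_pow_rdistr add.nat_pow_pow mult.commute)

lemma (in cring) add_pow_power:
  fixes i d :: "nat"
  assumes "x \<in> carrier R"
  shows "([i] \<cdot> x) [^] d = [(i ^ d)] \<cdot> (x [^] d)"
  using assms by (induction d) (simp_all add: add_pow_prod mult.commute)

lemma (in abelian_group) finsum_add_pow:
  fixes f :: "'i \<Rightarrow> nat"
  assumes "x \<in> carrier G" "finite A"
  shows "(\<Oplus>i\<in>A. [(f i)] \<cdot> x) = [(sum f A)] \<cdot> x"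
  using assms(2,1) by (induction A) (simp_all add: add.nat_pow_mult)

text \<open>Pascal's rule drives the induction. The expansion gives additivity of the Frobenius map
  and later isolates the leading power of \<beta> in a power of a conjugate.\<close>

lemma (in cring) binomial:
  fixes n :: "nat"
  assumes "x \<in> carrier R" "y \<in> carrier R"
  shows "(x \<oplus> y) [^] n = (\<Oplus>k\<in>{..n}. [(n choose k)] \<cdot> (x [^] k \<otimes> y [^] (n - k)))"
proof (induction n)
  case 0
  show ?case by simp
next
  case (Suc n)
  let ?t = "\<lambda>k. x [^] k \<otimes> y [^] (Suc n - k)"
  have t: "?t k \<in> carrier R" for k using assms by simp
  have "(x \<oplus> y) [^] Suc n = x \<otimes> (x \<oplus> y) [^] n \<oplus> y \<otimes> (x \<oplus> y) [^] n"
    using assms by (subst nat_pow_Suc2) (simp_all add: l_distr)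
  also have "x \<otimes> (x \<oplus> y) [^] n = (\<Oplus>k\<in>{..n}. [(n choose k)] \<cdot> ?t (Suc k))"
    unfolding Suc using assms
    by (auto simp add: finsum_rdistr add_pow_rdistr m_ac intro!: finsum_cong')
  \<comment> \<open>Shifting the index by one leaves a gap at \<open>k = 0\<close>; the coefficient
    0 placed there gives both sums the range \<open>{..Suc n}\<close>.\<close>
  also have "\<dots> = (\<Oplus>k\<in>{..Suc n}. [(if k = 0 then 0 else n choose (k - 1))] \<cdot> ?t k)"
    using t assms by (subst finsum_Suc2) auto
  also have "y \<otimes> (x \<oplus> y) [^] n = (\<Oplus>k\<in>{..n}. [(n choose k)] \<cdot> ?t k)"
    unfolding Suc using assms
    by (auto simp add: finsum_rdistr add_pow_rdistr m_ac Suc_diff_le intro!: finsum_cong')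
  also have "\<dots> = (\<Oplus>k\<in>{..Suc n}. [(n choose k)] \<cdot> ?t k)"
    using t assms by (simp add: binomial_eq_0)
  also have "(\<Oplus>k\<in>{..Suc n}. [(if k = 0 then 0 else n choose (k - 1))] \<cdot> ?t k) \<oplus>
      (\<Oplus>k\<in>{..Suc n}. [(n choose k)] \<cdot> ?t k) =
      (\<Oplus>k\<in>{..Suc n}. [(if k = 0 then 0 else n choose (k - 1))] \<cdot> ?t k \<oplus> [(n choose k)] \<cdot> ?t k)"
    using t by (subst finsum_addf) auto
  also have "\<dots> = (\<Oplus>k\<in>{..Suc n}. [(Suc n choose k)] \<cdot> ?t k)"
  proof (rule finsum_cong')
    fix k assume "k \<in> {..Suc n}"
    show "[(if k = 0 then 0 else n choose (k - 1))] \<cdot> ?t k \<oplus> [(n choose k)] \<cdot> ?t k = [(Suc n choose k)] \<cdot> ?t k"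
      using t[of k] by (cases k) (simp_all add: add.nat_pow_mult del: nat_pow_Suc)
  qed (use t in auto)
  finally show ?case .
qed

text \<open>Telescoping \<open>(i+1)^(d+1) - i^(d+1)\<close> over \<open>i < p\<close> writes
  \<open>p^(d+1)\<close> as a binomial combination of the power sums up to \<open>d\<close>. By
  induction \<open>p\<close> divides \<open>d + 1\<close> times the last of them, and
  \<open>0 < d + 1 < p\<close>. The convention \<open>0^0 = 1\<close> makes the sum for
  \<open>d = 0\<close> equal to \<open>p\<close>.\<close>

lemma prime_dvd_power_sum:
  fixes p d :: "nat"
  assumes "prime p" "d < p - 1"
  shows "p dvd (\<Sum>i<p. i ^ d)"
  using assms(2)
proof (induction d rule: less_induct)
  case (less d)
  have p: "p > 1" using assms(1) prime_gt_1_nat by blast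
  have "(\<Sum>i<n. (\<Sum>k\<le>d. (Suc d choose k) * i ^ k)) = n ^ Suc d" for n :: nat
  proof (induction n)
    case (Suc n)
    have "Suc n ^ Suc d = (\<Sum>k\<le>Suc d. (Suc d choose k) * n ^ k)"
      using binomial_ring[of n 1 "Suc d"] by simp
    also have "\<dots> = (\<Sum>k\<le>d. (Suc d choose k) * n ^ k) + n ^ Suc d" by simp
    finally show ?case using Suc by simp
  qed simp
  from this[of p] have eq: "(\<Sum>k\<le>d. (Suc d choose k) * (\<Sum>i<p. i ^ k)) = p ^ Suc d"
    by (subst (asm) sum.swap) (simp add: sum_distrib_left)
  have "p dvd (\<Sum>k<d. (Suc d choose k) * (\<Sum>i<p. i ^ k))"
    using less by (intro dvd_sum) auto
  moreover have "p dvd (\<Sum>k<d. (Suc d choose k) * (\<Sum>i<p. i ^ k)) + Suc d * (\<Sum>i<p. i ^ d)"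
    using eq by (simp add: lessThan_Suc_atMost[symmetric] del: power_Suc)
  ultimately have "p dvd Suc d * (\<Sum>i<p. i ^ d)"
    using dvd_add_right_iff by blast
  moreover have "\<not> p dvd Suc d" using less.prems by (auto dest: dvd_imp_le)
  ultimately show ?case using assms(1) prime_dvd_mult_iff by blast
qed

text \<open>By Fermat every \<open>i\<close> with \<open>0 < i < p\<close> contributes 1 modulo
  \<open>p\<close>, and \<open>i = 0\<close> contributes 0 since \<open>p - 1 > 0\<close>; the total
  is \<open>p - 1\<close>.\<close>

lemma prime_dvd_power_sum_minus_1:
  fixes p :: "nat"
  assumes "prime p"
  shows "p dvd (\<Sum>i<p. i ^ (p - 1)) + 1"
proof -
  have p: "p > 1" using assms prime_gt_1_nat by blast
  have "[(\<Sum>i\<in>{1..<p}. i ^ (p - 1)) = (\<Sum>i\<in>{1..<p}. 1)] (mod p)"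
    by (intro cong_sum fermat_theorem assms) (auto dest: dvd_imp_le)
  moreover have "(\<Sum>i<p. i ^ (p - 1)) = (\<Sum>i\<in>{1..<p}. i ^ (p - 1))"
    using p by (intro sum.mono_neutral_right) (auto simp: power_0_left)
  ultimately have "[(\<Sum>i<p. i ^ (p - 1)) + 1 = p] (mod p)"
    using p cong_add_rcancel_nat[of _ 1 "p - 1" p] by simp
  then show ?thesis by (simp add: cong_dvd_iff)
qed

section \<open>The Frobenius map in a field of characteristic \<open>p\<close>\<close>

locale prime_char_field = field R for R (structure) +
  fixes p :: nat
  assumes prime_p: "prime p" and char_p: "[p] \<cdot> \<one> = \<zero>"
begin

lemma p_gt_1: "p > 1"
  using prime_p prime_gt_1_nat by blast

lemma add_pow_dvd:
  assumes "x \<in> carrier R" "p dvd n"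
  shows "[n] \<cdot> x = \<zero>"
proof -
  obtain k where n: "n = p * k" using assms(2) by blast
  have "[n] \<cdot> x = [n] \<cdot> (\<one> \<otimes> x)" using assms by simp
  also have "\<dots> = ([p] \<cdot> \<one>) \<otimes> ([k] \<cdot> x)" unfolding n using assms by (intro add_pow_prod[symmetric]) auto
  finally show ?thesis using assms char_p by simp
qed

text \<open>An \<open>n\<close> prime to \<open>p\<close> has an inverse \<open>u\<close> modulo
  \<open>p\<close>, so the \<open>u\<close>-fold multiple of \<open>n x\<close> is \<open>x\<close>
  again.\<close>

lemma add_pow_eq_zero_iff:
  fixes n :: "nat"
  assumes "x \<in> carrier R" "x \<noteq> \<zero>"
  shows "[n] \<cdot> x = \<zero> \<longleftrightarrow> p dvd n"
proof
  assume 0: "[n] \<cdot> x = \<zero>"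
  show "p dvd n"
  proof (rule ccontr)
    assume "\<not> p dvd n"
    then obtain u where "[n * u = 1] (mod p)"
      using prime_p by (metis cong_solve_coprime_nat coprime_commute prime_imp_coprime One_nat_def)
    then obtain k l where kl: "n * u + p * k = 1 + p * l"
      by (metis cong_iff_lin_nat mult.commute)
    have "x = [(1 + p * l)] \<cdot> x"
      using assms by (simp add: add.nat_pow_mult[symmetric] add_pow_dvd)
    also have "\<dots> = [u] \<cdot> ([n] \<cdot> x)"
      unfolding kl[symmetric] using assms
      by (simp add: add.nat_pow_mult[symmetric] add_pow_dvd add.nat_pow_pow)
    finally show False using 0 assms by simp
  qed
qed (use assms add_pow_dvd in blast)

text \<open>\<open>p\<close> divides the binomial coefficients \<open>p choose k\<close> with
  \<open>0 < k < p\<close>, so only the two outer terms survive.\<close>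

lemma frobenius_add:
  assumes "x \<in> carrier R" "y \<in> carrier R"
  shows "(x \<oplus> y) [^] p = x [^] p \<oplus> y [^] p"
proof -
  let ?t = "\<lambda>k. [(p choose k)] \<cdot> (x [^] k \<otimes> y [^] (p - k))"
  have "?t k = \<zero>" if "k \<in> {..p} - {0, p}" for k
    using that assms prime_p by (intro add_pow_dvd dvd_choose_prime) auto
  then have "(\<Oplus>k\<in>{..p}. ?t k) = (\<Oplus>k\<in>{0, p}. ?t k)"
    using assms by (intro add.finprod_mono_neutral_cong_right) auto
  also have "\<dots> = x [^] p \<oplus> y [^] p"
    using assms p_gt_1 by (simp add: a_comm)
  finally show ?thesis using binomial[OF assms] by simp
qed

lemma frobenius_pow_add:
  assumes "x \<in> carrier R" "y \<in> carrier R"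
  shows "(x \<oplus> y) [^] (p ^ k) = x [^] (p ^ k) \<oplus> y [^] (p ^ k)"
  using assms by (induction k) (simp_all add: nat_pow_pow[symmetric] frobenius_add mult.commute[of p])

lemma frobenius_pow_neg:
  assumes "x \<in> carrier R"
  shows "(\<ominus> x) [^] (p ^ k) = \<ominus> (x [^] (p ^ k))"
proof -
  have "(\<ominus> x) [^] (p ^ k) \<oplus> x [^] (p ^ k) = (\<ominus> x \<oplus> x) [^] (p ^ k)"
    using assms by (subst frobenius_pow_add) auto
  also have "\<dots> = \<zero>" using assms p_gt_1 by (simp add: l_neg nat_pow_zero)
  finally show ?thesis using assms by (simp add: minus_equality)
qed

lemma frobenius_pow_minus:
  assumes "x \<in> carrier R" "y \<in> carrier R"
  shows "(x \<ominus> y) [^] (p ^ k) = x [^] (p ^ k) \<ominus> y [^] (p ^ k)"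
  using assms by (simp add: minus_eq frobenius_pow_add frobenius_pow_neg)

lemma frobenius_add_pow:
  fixes i :: "nat"
  assumes "x \<in> carrier R" "x [^] (p ^ k) = x"
  shows "([i] \<cdot> x) [^] (p ^ k) = [i] \<cdot> x"
  using assms p_gt_1 by (induction i) (simp_all add: frobenius_pow_add nat_pow_zero)

lemma power_sum_zero:
  assumes "g \<in> carrier R" "d < p - 1"
  shows "(\<Oplus>i\<in>{..<p}. ([i] \<cdot> g) [^] d) = \<zero>"
  using assms prime_dvd_power_sum[OF prime_p, of d]
  by (simp add: add_pow_power finsum_add_pow add_pow_dvd)

text \<open>A nonzero \<open>g\<close> with \<open>g^p = g\<close> satisfies
  \<open>g^(p-1) = 1\<close>, which leaves the integer power sum, congruent to -1 modulo
  \<open>p\<close>.\<close>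

lemma power_sum_minus_one:
  assumes "g \<in> carrier R" "g [^] p = g" "g \<noteq> \<zero>"
  shows "(\<Oplus>i\<in>{..<p}. ([i] \<cdot> g) [^] (p - 1)) = \<ominus> \<one>"
proof -
  have "g [^] (p - 1) \<otimes> g = \<one> \<otimes> g"
    using assms p_gt_1 nat_pow_Suc[of g "p - 1"] by simp
  then have g1: "g [^] (p - 1) = \<one>" using assms m_rcancel by blast
  let ?S = "\<Sum>i<p. i ^ (p - 1)"
  have "[(?S + 1)] \<cdot> \<one> = \<zero>"
    by (intro add_pow_dvd prime_dvd_power_sum_minus_1 prime_p) auto
  then have "[?S] \<cdot> \<one> \<oplus> \<one> = \<zero>" by simp
  then have "[?S] \<cdot> \<one> = \<ominus> \<one>" by (simp add: minus_equality)
  then show ?thesis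
    using assms g1 by (simp add: add_pow_power finsum_add_pow)
qed

text \<open>Since \<open>g\<close> is fixed by Frobenius, so is \<open>- i g\<close>, which
  therefore cannot be \<open>y\<close>.\<close>

lemma artin_schreier_shift_nonzero:
  fixes i :: "nat"
  assumes "g \<in> carrier R" "g [^] p = g" "y \<in> carrier R" "y [^] p \<noteq> y"
  shows "y \<oplus> [i] \<cdot> g \<noteq> \<zero>"
proof
  assume "y \<oplus> [i] \<cdot> g = \<zero>"
  then have y: "y = \<ominus> ([i] \<cdot> g)" using assms by (simp add: minus_equality)
  have "y [^] p = y"
    unfolding y using assms frobenius_add_pow[of g 1 i] frobenius_pow_neg[of "[i] \<cdot> g" 1] by simp
  then show False using assms by simp
qed

text \<open>With \<open>z d = \<Sum>\<^sub>i (i g)\<^sup>d / (y + i g)\<close> and the power sums \<open>s d\<close> one has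
  \<open>z (d + 1) = s d - y z d\<close>; since \<open>z p = z 1\<close>, this determines all \<open>z d\<close>.\<close>
lemma partial_fractions:
  assumes g: "g \<in> carrier R" "g [^] p = g" "g \<noteq> \<zero>"
    and y: "y \<in> carrier R" "y [^] p \<noteq> y" and d: "d < p"
  shows "(y [^] p \<ominus> y) \<otimes> (\<Oplus>i\<in>{..<p}. ([i] \<cdot> g) [^] d \<otimes> inv (y \<oplus> [i] \<cdot> g)) = \<ominus> ((\<ominus> y) [^] d)"
proof -
  define c where "c = (\<lambda>i::nat. [i] \<cdot> g)"
  define u where "u = (\<lambda>i::nat. inv (y \<oplus> c i))"
  define z where "z = (\<lambda>d::nat. \<Oplus>i\<in>{..<p}. c i [^] d \<otimes> u i)"
  define s where "s = (\<lambda>d::nat. \<Oplus>i\<in>{..<p}. c i [^] d)"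
  have c: "c i \<in> carrier R" for i unfolding c_def using g by simp
  have "y \<oplus> c i \<noteq> \<zero>" for i
    unfolding c_def by (rule artin_schreier_shift_nonzero) (use g y in auto)
  then have u: "u i \<in> carrier R" "(y \<oplus> c i) \<otimes> u i = \<one>" for i
    unfolding u_def using y c field_Units by auto
  have z: "z d \<in> carrier R" for d unfolding z_def using c u by auto
  have s: "s d \<in> carrier R" for d unfolding s_def using c by auto
  have step: "z (Suc d) \<oplus> y \<otimes> z d = s d" for d
  proof -
    have "z (Suc d) \<oplus> y \<otimes> z d = (\<Oplus>i\<in>{..<p}. c i [^] Suc d \<otimes> u i \<oplus> y \<otimes> (c i [^] d \<otimes> u i))"
      unfolding z_def using c u(1) y by (simp add: finsum_rdistr Pi_iff)
    also have "\<dots> = s d"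
      unfolding s_def
    proof (intro finsum_cong')
      fix i
      have "c i [^] Suc d \<otimes> u i \<oplus> y \<otimes> (c i [^] d \<otimes> u i) = c i [^] d \<otimes> ((y \<oplus> c i) \<otimes> u i)"
        using c[of i] u(1)[of i] y by (simp add: l_distr r_distr m_ac a_ac)
      then show "c i [^] Suc d \<otimes> u i \<oplus> y \<otimes> (c i [^] d \<otimes> u i) = c i [^] d"
        using c[of i] u(2)[of i] by simp
    qed (use c in auto)
    finally show ?thesis .
  qed
  have low: "z d = (\<ominus> y) [^] d \<otimes> z 0" if "d < p" for d
    using that
  proof (induction d)
    case (Suc d)
    have "z (Suc d) \<oplus> y \<otimes> z d = \<zero>"
      using step[of d] power_sum_zero[of g d] Suc.prems g(1) by (simp add: s_def c_def)
    then have "z (Suc d) = \<ominus> (y \<otimes> z d)" using y z by (simp add: minus_equality)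
    also have "\<dots> = \<ominus> (y \<otimes> ((\<ominus> y) [^] d \<otimes> z 0))" using Suc by simp
    also have "\<dots> = (\<ominus> y) [^] Suc d \<otimes> z 0" using y z[of 0] by (simp add: l_minus r_minus m_ac)
    finally show ?case .
  qed (use z in simp)
  have "c i [^] p = c i" for i
    unfolding c_def using frobenius_add_pow[of g 1] g by simp
  then have "z p = z 1"
    unfolding z_def using c u(1) by (intro finsum_cong') auto
  moreover have "z 1 = \<ominus> y \<otimes> z 0" using low[of 1] p_gt_1 y by simp
  moreover have "z p \<oplus> y \<otimes> z (p - 1) = \<ominus> \<one>"
    using step[of "p - 1"] power_sum_minus_one[OF g] p_gt_1 by (simp add: s_def c_def)
  moreover have "y \<otimes> z (p - 1) = y [^] p \<otimes> z 0"
  proof -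
    \<comment> \<open>The sign in \<open>y (-y)^(p-1) = -(-y)^p = y^p\<close> is settled by
      Frobenius commuting with negation, which covers \<open>p = 2\<close> as well.\<close>
    have "y \<otimes> ((\<ominus> y) [^] n \<otimes> z 0) = \<ominus> ((\<ominus> y) [^] Suc n) \<otimes> z 0" for n :: nat
      using y z[of 0] by (simp add: l_minus r_minus m_ac)
    from this[of "p - 1"] have "y \<otimes> z (p - 1) = \<ominus> ((\<ominus> y) [^] Suc (p - 1)) \<otimes> z 0"
      using low[of "p - 1"] p_gt_1 by simp
    then show ?thesis using p_gt_1 frobenius_pow_neg[OF y(1), of 1] y(1) by simp
  qed
  \<comment> \<open>With \<open>z p = z 1 = - y z 0\<close>, the recursion at
    \<open>d = p - 1\<close> becomes an equation for \<open>z 0\<close> alone.\<close>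
  ultimately have "(y [^] p \<ominus> y) \<otimes> z 0 = \<ominus> \<one>"
    using y z by (simp add: minus_eq l_distr a_comm)
  moreover have "(y [^] p \<ominus> y) \<otimes> z d = (\<ominus> y) [^] d \<otimes> ((y [^] p \<ominus> y) \<otimes> z 0)"
    unfolding low[OF d] using y z by (simp add: m_lcomm)
  ultimately show ?thesis
    unfolding z_def c_def u_def using y by (simp add: r_minus)
qed

end

section \<open>Finite dimension, finite fields and rupture fields\<close>

lemma (in ring) subgroup_finsum_closed:
  assumes V: "subgroup V (add_monoid R)" and f: "\<And>i. i \<in> A \<Longrightarrow> f i \<in> V"
  shows "(\<Oplus>i\<in>A. f i) \<in> V"
  using f
proof (induction A rule: infinite_finite_induct)
  case (insert a A)
  have c: "f i \<in> carrier R" if "i \<in> insert a A" for i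
    using insert.prems[OF that] subgroup.subset[OF V] by auto
  have "(\<Oplus>i\<in>insert a A. f i) = f a \<oplus> (\<Oplus>i\<in>A. f i)"
    using insert.hyps c by (intro finsum_insert) auto
  then show ?case
    using subgroup.m_closed[OF V, of "f a" "\<Oplus>i\<in>A. f i"] insert by simp
qed (use subgroup.one_closed[OF V] in simp_all)

text \<open>Each added basis vector \<open>v\<close> multiplies the size by \<open>card K\<close>:
  since \<open>v\<close> lies outside \<open>E\<close>, the representation \<open>k v + e\<close> is
  unique.\<close>

lemma (in ring) dimension_card:
  assumes "subfield K R" "finite K" "dimension n K E"
  shows "finite E \<and> card E = card K ^ n"
  using assms(3,1,2)
proof (induction rule: dimension.induct)
  case (Suc_dim v E n K)
  note E = space_subgroup_props[OF Suc_dim.prems(1) Suc_dim.hyps(3)]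
  note K = subringE[OF subfieldE(1)[OF Suc_dim.prems(1)]]
  have inj: "inj_on (\<lambda>(k, e). k \<otimes> v \<oplus> e) (K \<times> E)"
  proof (rule inj_onI, clarify)
    fix k e k' e'
    assume ke: "k \<in> K" "e \<in> E" "k' \<in> K" "e' \<in> E" and eq: "k \<otimes> v \<oplus> e = k' \<otimes> v \<oplus> e'"
    have c: "k \<in> carrier R" "k' \<in> carrier R" "e \<in> carrier R" "e' \<in> carrier R"
      using ke K(1) E(1) by auto
    have "(k \<ominus> k') \<otimes> v = (k \<otimes> v \<oplus> e) \<ominus> k' \<otimes> v \<ominus> e" using c Suc_dim.hyps(1) by algebra
    also have "\<dots> = e' \<oplus> \<ominus> e" unfolding eq using c Suc_dim.hyps(1) by algebra
    finally have "(k \<ominus> k') \<otimes> v \<in> E" using E(3,4) ke by simp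
    moreover have "k \<ominus> k' \<in> K" unfolding minus_eq using K(5,7) ke by simp
    \<comment> \<open>A nonzero coefficient could be divided out, putting \<open>v\<close> into
      \<open>E\<close>.\<close>
    ultimately have "k \<ominus> k' = \<zero>" using E(6)[of "k \<ominus> k'" v] Suc_dim.hyps(1,2) by blast
    then have "k = k'" using c by simp
    then show "k = k' \<and> e = e'" using eq c Suc_dim.hyps(1) by simp
  qed
  have "line_extension K v E = (\<lambda>(k, e). k \<otimes> v \<oplus> e) ` (K \<times> E)"
    by (auto simp: line_extension_mem_iff image_iff) blast+
  then show ?case using Suc_dim inj by (simp add: card_image card_cartesian_product)
qed simp

text \<open>An entry in the span of the later ones leaves the dimension alone, and any other raises
  it by one. Hence the dimension reaches the length only if no entry depends on those after
  it.\<close>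

lemma (in ring) spanning_list_dimension:
  assumes K: "subfield K R" and "set Us \<subseteq> carrier R"
  shows "\<exists>m \<le> length Us. dimension m K (Span K Us) \<and> (m = length Us \<longrightarrow> independent K Us)"
  using assms(2)
proof (induction Us)
  case (Cons u Us)
  then obtain m where m: "m \<le> length Us" "dimension m K (Span K Us)" "m = length Us \<longrightarrow> independent K Us"
    by auto
  show ?case
  proof (cases "u \<in> Span K Us")
    case True
    have "set (u # Us) \<subseteq> Span K Us" using True Cons.prems Span_base_incl[OF K] by auto
    then have "Span K (u # Us) = Span K Us"
      using mono_Span_subset[OF K] mono_Span[OF K, of Us u] Cons.prems by (metis subset_antisym insert_subset list.set(2))
    then show ?thesis using m by (intro exI[of _ m]) auto
  next
    case False
    then show ?thesis using m Cons.prems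
      by (intro exI[of _ "Suc m"]) (auto intro: Suc_dim li_Cons)
  qed
qed auto

corollary (in ring) spanning_list_independent:
  assumes "subfield K R" "dimension n K (Span K Us)" "set Us \<subseteq> carrier R" "length Us = n"
  shows "independent K Us"
  using spanning_list_dimension[OF assms(1,3)] dimension_is_inj[OF assms(1,2)] assms(4) by blast

section \<open>Power maps on finite fields\<close>

lemma (in field) finite_field_pow_card:
  assumes "finite (carrier R)" "x \<in> carrier R"
  shows "x [^] card (carrier R) = x"
proof (cases "x = \<zero>")
  case True
  have "card (carrier R) \<noteq> 0" using assms by auto
  then show ?thesis using True by (simp add: nat_pow_zero)
next
  case False
  interpret M: group "Multiplicative_Group.mult_of R" by (rule field_mult_group)
  have "x [^] (card (carrier R) - 1) = \<one>"
    using M.pow_order_eq_1[of x] assms False order_mult_of by (simp add: Multiplicative_Group.nat_pow_mult_of order_def)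
  moreover have "card (carrier R) > 0" using assms card_gt_0_iff by blast
  ultimately show ?thesis using assms nat_pow_Suc[of x "card (carrier R) - 1"] by simp
qed

text \<open>The equation \<open>x^q = x\<close> with \<open>q = card A\<close> has at most
  \<open>q\<close> solutions, and \<open>A\<close> already supplies \<open>q\<close>. It is applied
  with \<open>A\<close> the image of the base field and with \<open>A\<close> the prime
  field.\<close>

lemma (in field) fixed_points_of_power:
  assumes fin: "finite (carrier R)" and A: "A \<subseteq> carrier R" "card A > 1" "\<And>a. a \<in> A \<Longrightarrow> a [^] card A = a"
    and x: "x \<in> carrier R" "x [^] card A = x"
  shows "x \<in> A"
proof -
  let ?d = "card A"
  let ?U = "{y \<in> carrier R. y [^] (?d - 1) = \<one>}"
  let ?B = "{y \<in> carrier R. y [^] ?d = y}"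
  have "y [^] (?d - 1) = \<one>" if "y \<in> carrier R" "y [^] ?d = y" "y \<noteq> \<zero>" for y
  proof -
    have "y [^] (?d - 1) \<otimes> y = \<one> \<otimes> y"
      using that A(2) nat_pow_Suc[of y "?d - 1"] by simp
    then show ?thesis using that m_rcancel by blast
  qed
  then have "?B \<subseteq> insert \<zero> ?U" by blast
  then have "card ?B \<le> card (insert \<zero> ?U)" using fin by (intro card_mono) auto
  also have "\<dots> \<le> Suc (card ?U)" by (rule card_insert_le_m1[THEN le_trans]) auto
  also have "\<dots> \<le> ?d" using num_roots_le_deg[OF fin, of "?d - 1"] A(2) by simp
  finally have "card ?B \<le> ?d" .
  moreover have "A \<subseteq> ?B" using A by auto
  ultimately have "A = ?B" using fin by (intro card_seteq) auto
  then show ?thesis using x by blast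
qed

section \<open>Rupture fields and the roots in them\<close>

lemma (in field) rupture_embedding:
  assumes f: "f \<in> carrier (poly_ring R)" "pirreducible (carrier R) f"
  defines "L \<equiv> Rupt (carrier R) f"
    and "emb \<equiv> \<lambda>c. rupture_surj (carrier R) f (poly_of_const c)"
    and "x \<equiv> rupture_surj (carrier R) f X"
  shows "degree f > 0"
    and "field L"
    and "ring_hom_ring R L emb"
    and "ring.dimension L (degree f) (emb ` carrier R) (carrier L)"
    and "x \<in> carrier L"
    and "\<And>V. \<lbrakk> subgroup V (add_monoid L); \<And>c i. c \<in> carrier R \<Longrightarrow> emb c \<otimes>\<^bsub>L\<^esub> x [^]\<^bsub>L\<^esub> (i::nat) \<in> V \<rbrakk>
           \<Longrightarrow> carrier L \<subseteq> V"
proof -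
  note K = carrier_is_subfield and K' = carrier_is_subring
  interpret UP: domain "poly_ring R"
    using univ_poly_is_domain[OF K'] .
  interpret Hom: ring_hom_ring "poly_ring R" L "rupture_surj (carrier R) f"
    unfolding L_def using rupture_surj_hom(2)[OF K' f(1)] .
  show deg: "degree f > 0"
    using pirreducibleE(1,2)[OF K' f] f(1) univ_poly_units'[OF K, of f] by simp
  show "field L" unfolding L_def using iffD2[OF rupture_is_field_iff_pirreducible[OF K f(1)] f(2)] .
  have "emb \<in> ring_hom R L"
    using rupture_surj_norm_is_hom[OF K' f(1)] unfolding emb_def L_def comp_def by simp
  then show "ring_hom_ring R L emb"
    using Hom.S.ring_axioms ring_axioms by (simp add: ring_hom_ring_def ring_hom_ring_axioms_def)
  show "ring.dimension L (degree f) (emb ` carrier R) (carrier L)"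
    using rupture_dimension[OF K f(1) deg] unfolding L_def emb_def by (simp add: image_image)
  show x: "x \<in> carrier L" unfolding x_def using Hom.hom_closed var_closed(1)[OF K'] by blast
  \<comment> \<open>Every residue class is a polynomial evaluated at the class \<open>x\<close> of
    the indeterminate, so the terms \<open>c x^i\<close> generate the field additively.\<close>
  show "carrier L \<subseteq> V"
    if V: "subgroup V (add_monoid L)" "\<And>c i. c \<in> carrier R \<Longrightarrow> emb c \<otimes>\<^bsub>L\<^esub> x [^]\<^bsub>L\<^esub> (i::nat) \<in> V" for V
  proof
    fix y assume "y \<in> carrier L"
    then obtain g where g: "g \<in> carrier (poly_ring R)" and y: "y = rupture_surj (carrier R) f g"
      unfolding L_def rupture_def FactRing_def A_RCOSETS_def' by auto
    have t: "emb (fst t) \<otimes>\<^bsub>L\<^esub> x [^]\<^bsub>L\<^esub> snd t \<in> V" 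
         "rupture_surj (carrier R) f [fst t] = emb (fst t)" if "t \<in> set (dense_repr g)" for t
    proof -
      \<comment> \<open>The dense representation lists only nonzero coefficients, so the constant
        polynomial of each is the one-entry list.\<close>
      have "fst t \<in> carrier R - {\<zero>}"
        using dense_repr_set_fst[of g "carrier R"] g that polynomial_incl univ_poly_carrier by blast
      then show "emb (fst t) \<otimes>\<^bsub>L\<^esub> x [^]\<^bsub>L\<^esub> snd t \<in> V" 
         "rupture_surj (carrier R) f [fst t] = emb (fst t)"
        using V(2)[of "fst t" "snd t"] by (simp_all add: emb_def poly_of_const_def)
    qed
    have "y = (\<Oplus>\<^bsub>L\<^esub> t \<in> set (dense_repr g). emb (fst t) \<otimes>\<^bsub>L\<^esub> x [^]\<^bsub>L\<^esub> snd t)"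
      unfolding y hom_var_pow_finsum[OF K' g Hom.ring_hom_ring_axioms] x_def[symmetric]
      using t V(1) Hom.S.add.finprod_cong' subgroup.subset[OF V(1)]
      by (intro Hom.S.finsum_cong') (auto simp: Pi_iff)
    also have "\<dots> \<in> V"
      using t(1) by (intro Hom.S.subgroup_finsum_closed V(1))
    finally show "y \<in> V" .
  qed
qed


lemma (in field) artin_schreier_poly_closed:
  assumes "a \<in> carrier R" "p > 1"
  shows "artin_schreier_poly R p a \<in> carrier (poly_ring R)" (is ?closed)
    and "degree (artin_schreier_poly R p a) = p" (is ?deg)
proof -
  note K' = carrier_is_subring
  interpret UP: domain "poly_ring R"
    using univ_poly_is_domain[OF K'] .
  have X: "X \<in> carrier (poly_ring R)" using var_closed(1)[OF K'] .
  have c: "poly_of_const a \<in> carrier (poly_ring R)" "degree (poly_of_const a) = 0"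
    using poly_of_const_over_carrier assms by blast+
  show ?closed unfolding artin_schreier_poly_def using X c by simp
  have len: "length (\<ominus>\<^bsub>poly_ring R\<^esub> q) = length q" if "q \<in> carrier (poly_ring R)" for q
    using univ_poly_a_inv_length[OF K' that] .
  have add: "degree (q \<oplus>\<^bsub>poly_ring R\<^esub> r) = degree q" 
    if "q \<in> carrier (poly_ring R)" "r \<in> carrier (poly_ring R)" "degree r < degree q" for q r
    using poly_add_degree_eq[OF K', of q r] that by (simp add: univ_poly_add univ_poly_carrier)
  have "degree (X [^]\<^bsub>poly_ring R\<^esub> p) = p"
    using polynomial_pow_degree[OF X] by (simp add: var_def)
  then have 1: "degree ((X [^]\<^bsub>poly_ring R\<^esub> p) \<ominus>\<^bsub>poly_ring R\<^esub> X) = p"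
    unfolding UP.minus_eq using X assms(2) by (subst add) (auto simp: len var_def)
  then show ?deg
    unfolding artin_schreier_poly_def using X c assms(2)
    by (subst UP.minus_eq, subst add) (auto simp: len)
qed

text \<open>Letting \<open>f\<close> be any divisor makes the result serve irreducible factors of an
  Artin-Schreier polynomial not yet known to be irreducible.\<close>

lemma (in field) artin_schreier_rupture_root:
  assumes f: "f \<in> carrier (poly_ring R)" "f pdivides artin_schreier_poly R p a" and a: "a \<in> carrier R"
  defines "L \<equiv> Rupt (carrier R) f"
    and "emb \<equiv> \<lambda>c. rupture_surj (carrier R) f (poly_of_const c)"
    and "x \<equiv> rupture_surj (carrier R) f X"
  shows "x [^]\<^bsub>L\<^esub> p = x \<oplus>\<^bsub>L\<^esub> emb a"
proof -
  note K' = carrier_is_subring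
  interpret UP: domain "poly_ring R"
    using univ_poly_is_domain[OF K'] .
  interpret Hom: ring_hom_ring "poly_ring R" L "rupture_surj (carrier R) f"
    unfolding L_def using rupture_surj_hom(2)[OF K' f(1)] .
  have X: "X \<in> carrier (poly_ring R)" using var_closed(1)[OF K'] .
  have c: "poly_of_const a \<in> carrier (poly_ring R)" 
    using poly_of_const_over_carrier a by blast+
  have carr: "x \<in> carrier L" "emb a \<in> carrier L" unfolding x_def emb_def using X c by auto
  have "artin_schreier_poly R p a \<in> PIdl\<^bsub>poly_ring R\<^esub> f"
    using f(2) UP.m_comm f(1) unfolding pdivides_def factor_def cgenideal_def by auto
  then have "rupture_surj (carrier R) f (artin_schreier_poly R p a) = \<zero>\<^bsub>L\<^esub>"
    using UP.a_rcos_zero[OF UP.cgenideal_ideal[OF f(1)]]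
    unfolding L_def rupture_def FactRing_def by simp
  then have "x [^]\<^bsub>L\<^esub> p \<ominus>\<^bsub>L\<^esub> x \<ominus>\<^bsub>L\<^esub> emb a = \<zero>\<^bsub>L\<^esub>"
    unfolding artin_schreier_poly_def x_def emb_def using X c
    by (simp add: UP.minus_eq Hom.S.minus_eq Hom.hom_nat_pow)
  then have "x [^]\<^bsub>L\<^esub> p = (x [^]\<^bsub>L\<^esub> p \<ominus>\<^bsub>L\<^esub> x \<ominus>\<^bsub>L\<^esub> emb a) \<oplus>\<^bsub>L\<^esub> (x \<oplus>\<^bsub>L\<^esub> emb a) \<Longrightarrow> ?thesis"
    using carr by simp
  moreover have "x [^]\<^bsub>L\<^esub> p = (x [^]\<^bsub>L\<^esub> p \<ominus>\<^bsub>L\<^esub> x \<ominus>\<^bsub>L\<^esub> emb a) \<oplus>\<^bsub>L\<^esub> (x \<oplus>\<^bsub>L\<^esub> emb a)"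
  proof -
    have "u = (u \<ominus>\<^bsub>L\<^esub> x \<ominus>\<^bsub>L\<^esub> emb a) \<oplus>\<^bsub>L\<^esub> (x \<oplus>\<^bsub>L\<^esub> emb a)" if "u \<in> carrier L" for u
      using that carr by algebra
    then show ?thesis using carr by simp
  qed
  ultimately show ?thesis by blast
qed

section \<open>The trace criterion for irreducibility\<close>

lemma (in ring_hom_ring) hom_add_pow:
  fixes n :: nat
  assumes "x \<in> carrier R"
  shows "h ([n] \<cdot>\<^bsub>R\<^esub> x) = [n] \<cdot>\<^bsub>S\<^esub> h x"
  using assms by (induction n) simp_all

lemma (in prime_char_field) prime_char_field_hom:
  assumes "ring_hom_ring R S h" "field S"
  shows "prime_char_field S p"
proof -
  interpret h: ring_hom_ring R S h by fact
  interpret S: field S by fact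
  show ?thesis
    by unfold_locales (use prime_p char_p h.hom_add_pow[of \<one> p] in simp_all)
qed

text \<open>The setting is an extension of \<open>F\<close> with a root \<beta>, so it covers the
  rupture field of an irreducible factor as well as the extension of the theorem.\<close>

locale artin_schreier_root_field = prime_char_field L p + F: prime_char_field F p + emb: ring_hom_ring F L emb
  for L :: "('b, 'c) ring_scheme" (structure) and p and F :: "('a, 'd) ring_scheme" and emb +
  fixes N :: nat and \<alpha> \<beta>
  assumes finite_F: "finite (carrier F)" and card_F: "card (carrier F) = p ^ N"
    and \<alpha>_closed: "\<alpha> \<in> carrier F" and \<beta>_closed: "\<beta> \<in> carrier L"
    and \<beta>_pow_p: "\<beta> [^] p = \<beta> \<oplus> emb \<alpha>"
begin

text \<open>The absolute trace of \<alpha>, carried into \<open>L\<close>. Raising to the power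
  \<open>p^N\<close> adds it to \<beta>.\<close>

definition \<tau> :: 'b where "\<tau> = emb (\<Oplus>\<^bsub>F\<^esub>j\<in>{..<N}. \<alpha> [^]\<^bsub>F\<^esub> (p ^ j))"

lemma \<tau>_closed: "\<tau> \<in> carrier L"
  unfolding \<tau>_def using \<alpha>_closed by (intro emb.hom_closed F.finsum_closed) auto

lemma inj_emb: "inj_on emb (carrier F)"
  using non_trivial_field_hom_is_inj[OF emb.homh F.field_axioms field_axioms] .

lemma emb_pow_card:
  assumes "a \<in> carrier F"
  shows "emb a [^] (p ^ (N * i)) = emb a"
proof (induction i)
  case (Suc i)
  have "emb a [^] (p ^ N) = emb a"
    using F.finite_field_pow_card[OF finite_F assms] assms card_F
    by (metis emb.hom_nat_pow)
  then show ?case using Suc assms by (simp add: power_add nat_pow_pow[symmetric])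
qed (use assms in simp)

lemma \<beta>_pow:
  "\<beta> [^] (p ^ k) = \<beta> \<oplus> emb (\<Oplus>\<^bsub>F\<^esub>j\<in>{..<k}. \<alpha> [^]\<^bsub>F\<^esub> (p ^ j))"
proof (induction k)
  case (Suc k)
  let ?t = "\<Oplus>\<^bsub>F\<^esub>j\<in>{..<k}. \<alpha> [^]\<^bsub>F\<^esub> (p ^ j)"
  have t: "?t \<in> carrier F" using \<alpha>_closed by simp
  have "\<beta> [^] (p ^ Suc k) = (\<beta> \<oplus> emb \<alpha>) [^] (p ^ k)"
    using \<beta>_closed by (simp add: nat_pow_pow[symmetric] \<beta>_pow_p)
  also have "\<dots> = \<beta> \<oplus> (emb (\<alpha> [^]\<^bsub>F\<^esub> (p ^ k)) \<oplus> emb ?t)"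
    using \<beta>_closed \<alpha>_closed t by (simp add: frobenius_pow_add Suc emb.hom_nat_pow a_ac)
  also have "emb (\<alpha> [^]\<^bsub>F\<^esub> (p ^ k)) \<oplus> emb ?t = emb (\<Oplus>\<^bsub>F\<^esub>j\<in>{..<Suc k}. \<alpha> [^]\<^bsub>F\<^esub> (p ^ j))"
    using \<alpha>_closed t by (simp add: lessThan_Suc)
  finally show ?case .
qed (use \<beta>_closed in simp)

text \<open>Raising \<beta> to the powers \<open>p^N\<close> and \<open>p\<close> in the two
  possible orders gives \<open>\<beta> + \<alpha> + \<tau>^p\<close> and
  \<open>\<beta> + \<alpha> + \<tau>\<close>, as \<alpha> is fixed by the power
  \<open>p^N\<close>.\<close>

lemma \<tau>_pow_p: "\<tau> [^] p = \<tau>"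
proof -
  have "(\<beta> \<oplus> emb \<alpha>) \<oplus> \<tau> [^] p = (\<beta> [^] (p ^ N)) [^] p"
    using \<beta>_closed \<tau>_closed by (simp add: \<beta>_pow \<tau>_def[symmetric] frobenius_add \<beta>_pow_p)
  also have "\<dots> = (\<beta> [^] p) [^] (p ^ N)"
    using \<beta>_closed by (simp add: nat_pow_pow mult.commute)
  also have "\<dots> = (\<beta> \<oplus> emb \<alpha>) \<oplus> \<tau>"
    using \<beta>_closed \<tau>_closed \<alpha>_closed emb_pow_card[of \<alpha> 1]
    by (simp add: \<beta>_pow_p frobenius_pow_add \<beta>_pow \<tau>_def[symmetric] a_ac)
  finally show ?thesis using \<beta>_closed \<tau>_closed \<alpha>_closed by simp
qed

lemma \<tau>_pow: "\<tau> [^] (p ^ k) = \<tau>"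
  by (induction k) (use \<tau>_closed \<tau>_pow_p in \<open>simp_all add: nat_pow_pow[symmetric]\<close>)

lemma shift_pow_card:
  assumes "a \<in> carrier F"
  shows "(\<beta> \<oplus> emb a) [^] (p ^ (N * i)) = \<beta> \<oplus> emb a \<oplus> [i] \<cdot> \<tau>"
proof (induction i)
  case (Suc i)
  have "(\<beta> \<oplus> emb a) [^] (p ^ (N * Suc i)) = (\<beta> \<oplus> emb a \<oplus> [i] \<cdot> \<tau>) [^] (p ^ N)"
    using Suc assms \<beta>_closed by (simp add: power_add nat_pow_pow[symmetric] mult.commute[of "p ^ N"])
  also have "\<dots> = (\<beta> \<oplus> \<tau>) \<oplus> emb a \<oplus> [i] \<cdot> \<tau>"
    using assms \<beta>_closed \<tau>_closed emb_pow_card[OF assms, of 1] frobenius_add_pow[of \<tau> N i] \<tau>_pow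
    by (simp add: frobenius_pow_add \<beta>_pow \<tau>_def[symmetric])
  finally show ?case using assms \<beta>_closed \<tau>_closed by (simp add: a_ac)
qed (use assms \<beta>_closed in simp)

text \<open>In a field of \<open>p^(N d)\<close> elements \<beta> equals its own power with that
  exponent, so the accumulated shift \<open>d \<tau>\<close> vanishes.\<close>

lemma p_dvd_extension_degree:
  assumes "\<tau> \<noteq> \<zero>" "finite (carrier L)" "card (carrier L) = p ^ (N * d)"
  shows "p dvd d"
proof -
  have "\<beta> \<oplus> [d] \<cdot> \<tau> = \<beta> \<oplus> \<zero>"
    using shift_pow_card[of "\<zero>\<^bsub>F\<^esub>" d] finite_field_pow_card[OF assms(2) \<beta>_closed] assms(3) \<beta>_closed \<tau>_closed
    by simp
  then have "[d] \<cdot> \<tau> = \<zero>" using \<beta>_closed \<tau>_closed by (metis add.l_cancel add.nat_pow_closed zero_closed)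
  then show ?thesis using add_pow_eq_zero_iff \<tau>_closed assms(1) by blast
qed

text \<open>With zero trace \<beta> solves \<open>x^q = x\<close> for \<open>q = p^N\<close>, and
  the image of \<open>F\<close> holds all solutions.\<close>

lemma \<beta>_in_base_field:
  assumes "\<tau> = \<zero>" "finite (carrier L)"
  shows "\<beta> \<in> emb ` carrier F"
proof -
  have card: "card (emb ` carrier F) = p ^ N"
    using card_image[OF inj_emb] card_F by simp
  have "card {\<zero>\<^bsub>F\<^esub>, \<one>\<^bsub>F\<^esub>} \<le> card (carrier F)" using finite_F by (intro card_mono) auto
  then have gt: "p ^ N > 1" using card_F by simp
  show ?thesis
  proof (rule fixed_points_of_power[OF assms(2), of "emb ` carrier F", unfolded card])
    show "a [^] (p ^ N) = a" if "a \<in> emb ` carrier F" for a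
      using that emb_pow_card[of _ 1] by auto
    show "\<beta> [^] (p ^ N) = \<beta>" using \<beta>_pow[of N] assms(1) \<beta>_closed by (simp add: \<tau>_def)
  qed (use gt \<beta>_closed in auto)
qed

end

lemma (in prime_char_field) rupture_artin_schreier_root_field:
  assumes f: "f \<in> carrier (poly_ring R)" "pirreducible (carrier R) f" "f pdivides artin_schreier_poly R p a"
    and fin: "finite (carrier R)" "card (carrier R) = p ^ N" and a: "a \<in> carrier R"
  shows "artin_schreier_root_field (Rupt (carrier R) f) p R (\<lambda>c. rupture_surj (carrier R) f (poly_of_const c))
      N a (rupture_surj (carrier R) f X)" (is ?root)
    and "finite (carrier (Rupt (carrier R) f))"
    and "card (carrier (Rupt (carrier R) f)) = p ^ (N * degree f)"
proof -
  let ?L = "Rupt (carrier R) f" and ?emb = "\<lambda>c. rupture_surj (carrier R) f (poly_of_const c)"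
  note r = rupture_embedding[OF f(1,2)]
  interpret L: prime_char_field ?L p
    using prime_char_field_hom[OF r(3,2)] .
  show root: ?root
    using prime_char_field_axioms L.prime_char_field_axioms r(3,5) fin a artin_schreier_rupture_root[OF f(1,3) a]
    by (simp add: artin_schreier_root_field_def artin_schreier_root_field_axioms_def)
  interpret A: artin_schreier_root_field ?L p R ?emb N a "rupture_surj (carrier R) f X" by (fact root)
  have sub: "subfield (?emb ` carrier R) ?L"
    using A.emb.img_is_subfield(2)[OF carrier_is_subfield] L.one_not_zero by simp
  have card: "card (?emb ` carrier R) = p ^ N" using card_image[OF A.inj_emb] fin by simp
  show "finite (carrier ?L)" "card (carrier ?L) = p ^ (N * degree f)"
    using L.dimension_card[OF sub _ r(4)] fin card by (simp_all add: power_mult)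
qed

text \<open>A vanishing trace would put the root into the base field, while modulo a polynomial of
  degree \<open>p > 1\<close> the class of \<open>X\<close> is not that of a constant.\<close>

lemma (in prime_char_field) artin_schreier_irreducible_imp_trace_nonzero:
  assumes fin: "finite (carrier R)" "card (carrier R) = p ^ N" and a: "a \<in> carrier R"
    and irr: "pirreducible (carrier R) (artin_schreier_poly R p a)"
  shows "(\<Oplus>j\<in>{..<N}. a [^] (p ^ j)) \<noteq> \<zero>"
proof
  assume 0: "(\<Oplus>j\<in>{..<N}. a [^] (p ^ j)) = \<zero>"
  let ?f = "artin_schreier_poly R p a"
  note f = artin_schreier_poly_closed[OF a p_gt_1]
  interpret UP: domain "poly_ring R" using univ_poly_is_domain[OF carrier_is_subring] .
  have "?f pdivides ?f" using f(1) by (simp add: pdivides_def)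
  note r = rupture_artin_schreier_root_field[OF f(1) irr this fin a]
  interpret A: artin_schreier_root_field "Rupt (carrier R) ?f" p R
    "\<lambda>c. rupture_surj (carrier R) ?f (poly_of_const c)" N a "rupture_surj (carrier R) ?f X"
    by (fact r(1))
  have "A.\<tau> = \<zero>\<^bsub>Rupt (carrier R) ?f\<^esub>" unfolding A.\<tau>_def 0 by simp
  from A.\<beta>_in_base_field[OF this r(2)] obtain c
    where c: "c \<in> carrier R" "rupture_surj (carrier R) ?f X = rupture_surj (carrier R) ?f (poly_of_const c)"
    by blast
  have pc: "poly_of_const c \<in> carrier (poly_ring R)" "degree (poly_of_const c) = 0"
    using poly_of_const_over_carrier c(1) by blast+
  have X: "X \<in> carrier (poly_ring R)" "degree X = 1" using var_closed(1)[OF carrier_is_subring] by (simp_all add: var_def)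
  \<comment> \<open>Both polynomials have degree below \<open>p\<close> and are their own
    remainders, so \<open>X\<close> would be constant.\<close>
  have "X pmod ?f = poly_of_const c pmod ?f"
  proof (rule inj_onD[OF rupture_surj_inj_on[OF carrier_is_subfield f(1)]])
    show "rupture_surj (carrier R) ?f (X pmod ?f) = rupture_surj (carrier R) ?f (poly_of_const c pmod ?f)"
      using c(2) rupture_surj_composed_with_pmod[OF carrier_is_subfield f(1)] X(1) pc(1) by metis
  qed (use X(1) pc(1) in blast)+
  then show False using pmod_const(2)[OF carrier_is_subfield _ f(1), of X] 
   pmod_const(2)[OF carrier_is_subfield _ f(1), of "poly_of_const c"] f(2) p_gt_1 X pc by simp
qed

text \<open>A nonunit divisor has an irreducible factor, in whose rupture field the shift argument
  makes \<open>p\<close> divide the degree. Two nonunit factors would need total degree at least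
  \<open>2 p\<close>.\<close>

lemma (in prime_char_field) trace_nonzero_imp_artin_schreier_irreducible:
  assumes fin: "finite (carrier R)" "card (carrier R) = p ^ N" and a: "a \<in> carrier R"
    and tr: "(\<Oplus>j\<in>{..<N}. a [^] (p ^ j)) \<noteq> \<zero>"
  shows "pirreducible (carrier R) (artin_schreier_poly R p a)"
proof -
  let ?f = "artin_schreier_poly R p a"
  note f = artin_schreier_poly_closed[OF a p_gt_1]
  note K = carrier_is_subfield and K' = carrier_is_subring
  interpret UP: principal_domain "poly_ring R" using univ_poly_is_principal[OF K] .
  note units = univ_poly_units'[OF K]
  have "?f \<notin> Units (poly_ring R)" using f p_gt_1 units[of ?f] by simp
  moreover have "?f \<noteq> []" using f(2) p_gt_1 by force
  ultimately have f0: "?f \<noteq> []" "?f \<notin> Units (poly_ring R)" by blast+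
  have dvd: "p \<le> degree g"
    if g: "g \<in> carrier (poly_ring R)" "g \<notin> Units (poly_ring R)" "g pdivides ?f" for g
  proof -
    have "g \<noteq> []" using g(3) f0 zero_pdivides by blast
    then have g0: "g \<in> carrier (poly_ring R) - {\<zero>\<^bsub>poly_ring R\<^esub>}" using g(1) by (simp add: univ_poly_zero)
    obtain e where e: "e \<in> carrier (poly_ring R)" "pirreducible (carrier R) e" "e pdivides g"
      using UP.exists_irreducible_divisor[OF g0 g(2)] unfolding pdivides_def .
    have "e pdivides ?f"
      using UP.divides_trans[OF e(3)[unfolded pdivides_def] g(3)[unfolded pdivides_def] e(1)] unfolding pdivides_def .
    note r = rupture_artin_schreier_root_field[OF e(1,2) this fin a]
    interpret A: artin_schreier_root_field "Rupt (carrier R) e" p R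
      "\<lambda>c. rupture_surj (carrier R) e (poly_of_const c)" N a "rupture_surj (carrier R) e X"
      by (fact r(1))
    have "A.\<tau> \<noteq> \<zero>\<^bsub>Rupt (carrier R) e\<^esub>"
      unfolding A.\<tau>_def using tr inj_onD[OF A.inj_emb, of "\<Oplus>j\<in>{..<N}. a [^] (p ^ j)" \<zero>] a by fastforce
    then have "p dvd degree e" using A.p_dvd_extension_degree r by blast
    then have "p \<le> degree e" using rupture_embedding(1)[OF e(1,2)] by (auto dest: dvd_imp_le)
    also have "\<dots> \<le> degree g" using pdivides_imp_degree_le[OF K' e(1) g(1) \<open>g \<noteq> []\<close> e(3)] .
    finally show ?thesis .
  qed
  show ?thesis
  proof (rule pirreducibleI[OF K' f(1) f0])
    fix q r assume qr: "q \<in> carrier (poly_ring R)" "r \<in> carrier (poly_ring R)" "?f = q \<otimes>\<^bsub>poly_ring R\<^esub> r"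
    have "q \<noteq> []" "r \<noteq> []" using qr f0 UP.l_null UP.r_null by (auto simp: univ_poly_zero)
    then have deg: "degree q + degree r = p"
      using poly_mult_degree_eq[OF K', of q r] qr f(2) by (simp add: univ_poly_mult univ_poly_carrier)
    show "q \<in> Units (poly_ring R) \<or> r \<in> Units (poly_ring R)"
    proof (rule ccontr)
      assume n: "\<not> ?thesis"
      have "q pdivides ?f" "r pdivides ?f"
        using qr UP.m_comm unfolding pdivides_def factor_def by auto
      then have "p \<le> degree q" "p \<le> degree r" using dvd qr n by blast+
      then show False using deg p_gt_1 by simp
    qed
  qed
qed

section \<open>Irreducible Artin-Schreier extensions\<close>

lemma (in ring) subalgebra_closed:
  assumes "subalgebra K V R"
  shows "V \<subseteq> carrier R" "\<zero> \<in> V"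
    and "\<And>u v. \<lbrakk> u \<in> V; v \<in> V \<rbrakk> \<Longrightarrow> u \<oplus> v \<in> V"
    and "\<And>v. v \<in> V \<Longrightarrow> \<ominus> v \<in> V"
    and "\<And>u v. \<lbrakk> u \<in> V; v \<in> V \<rbrakk> \<Longrightarrow> u \<ominus> v \<in> V"
    and "\<And>k v. \<lbrakk> k \<in> K; v \<in> V \<rbrakk> \<Longrightarrow> k \<otimes> v \<in> V"
    and "\<And>f A. (\<And>i. i \<in> A \<Longrightarrow> f i \<in> V) \<Longrightarrow> (\<Oplus>i\<in>A. f i) \<in> V"
    and "\<And>n v. v \<in> V \<Longrightarrow> [(n::nat)] \<cdot> v \<in> V"
proof -
  have V: "subgroup V (add_monoid R)" using assms by (simp add: subalgebra_def)
  show "V \<subseteq> carrier R" "\<zero> \<in> V" and add: "\<And>u v. \<lbrakk> u \<in> V; v \<in> V \<rbrakk> \<Longrightarrow> u \<oplus> v \<in> V"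
    and neg: "\<And>v. v \<in> V \<Longrightarrow> \<ominus> v \<in> V"
    using subgroup.subset[OF V] subgroup.one_closed[OF V] subgroup.m_closed[OF V] subgroup.m_inv_closed[OF V]
    by (auto simp: a_inv_def)
  show "\<And>u v. \<lbrakk> u \<in> V; v \<in> V \<rbrakk> \<Longrightarrow> u \<ominus> v \<in> V" using add neg by (simp add: minus_eq)
  show "\<And>k v. \<lbrakk> k \<in> K; v \<in> V \<rbrakk> \<Longrightarrow> k \<otimes> v \<in> V" using subalgebra.smult_closed[OF assms] .
  show "\<And>f A. (\<And>i. i \<in> A \<Longrightarrow> f i \<in> V) \<Longrightarrow> (\<Oplus>i\<in>A. f i) \<in> V"
    using subgroup_finsum_closed[OF V] .
  show "[(n::nat)] \<cdot> v \<in> V" if "v \<in> V" for n v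
    by (induction n) (use that \<open>\<zero> \<in> V\<close> add in simp_all)
qed

lemma (in field) inv_nonzero:
  assumes "x \<in> carrier R" "x \<noteq> \<zero>"
  shows "inv x \<in> carrier R" "x \<otimes> inv x = \<one>" "inv x \<otimes> x = \<one>" "inv x \<noteq> \<zero>"
proof -
  have x: "x \<in> Units R" using assms field_Units by simp
  then show "inv x \<in> carrier R" and r: "x \<otimes> inv x = \<one>" "inv x \<otimes> x = \<one>" by simp_all
  show "inv x \<noteq> \<zero>" using r(1) assms(1) by auto
qed

lemma (in field) inv_eqI:
  assumes "x \<in> carrier R" "y \<in> carrier R" "x \<otimes> y = \<one>"
  shows "inv x = y"
  using assms comm_inv_char by blast

lemma (in domain) nat_pow_nonzero:
  fixes n :: nat
  assumes "x \<in> carrier R" "x \<noteq> \<zero>"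
  shows "x [^] n \<noteq> \<zero>"
  by (induction n) (use assms integral in auto)

lemma (in field) inv_nat_pow:
  fixes n :: nat
  assumes "x \<in> carrier R" "x \<noteq> \<zero>"
  shows "inv x [^] n = inv (x [^] n)"
  using assms inv_nonzero[OF assms]
  by (intro inv_eqI[symmetric]) (simp_all add: nat_pow_distrib[symmetric])

lemma (in field) hom_inv:
  assumes "ring_hom_ring R S h" "field S" "x \<in> carrier R" "x \<noteq> \<zero>"
  shows "h (inv x) = inv\<^bsub>S\<^esub> (h x)"
proof -
  interpret h: ring_hom_ring R S h by fact
  note x = inv_nonzero[OF assms(3,4)]
  have "h x \<otimes>\<^bsub>S\<^esub> h (inv x) = \<one>\<^bsub>S\<^esub>" using x assms(3) by (metis h.hom_mult h.hom_one)
  then show ?thesis using field.inv_eqI[OF assms(2)] x assms(3) by (metis h.hom_closed)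
qed

lemma (in ring) subring_add_pow_one:
  fixes n :: nat
  assumes "subring K R"
  shows "[n] \<cdot> \<one> \<in> K"
  by (induction n) (use subringE[OF assms] in simp_all)

lemma (in prime_char_field) add_pow_inj_on:
  assumes x: "x \<in> carrier R" "x \<noteq> \<zero>"
  shows "inj_on (\<lambda>i::nat. [i] \<cdot> x) {..<p}"
proof (rule linorder_inj_onI)
  fix i j :: nat assume ij: "i < j" "j \<in> {..<p}"
  show "[i] \<cdot> x \<noteq> [j] \<cdot> x"
  proof
    assume eq: "[i] \<cdot> x = [j] \<cdot> x"
    have "[i] \<cdot> x \<oplus> [(j - i)] \<cdot> x = [i] \<cdot> x \<oplus> \<zero>"
      using ij x eq add.nat_pow_mult[of x i "j - i"] by simp
    then have "[(j - i)] \<cdot> x = \<zero>" using x by (metis add.l_cancel add.nat_pow_closed zero_closed)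
    then have "p dvd j - i" using add_pow_eq_zero_iff x by simp
    then show False using ij by (auto dest: dvd_imp_le)
  qed
qed auto

text \<open>The \<open>p\<close> multiples of 1 exhaust the solutions of \<open>x^p = x\<close>, and
  every subring contains them. This places \<tau> in each subfield from which coefficients are
  drawn.\<close>

lemma (in prime_char_field) prime_subfield_mem:
  assumes fin: "finite (carrier R)" and x: "x \<in> carrier R" "x [^] p = x" and K: "subring K R"
  shows "x \<in> K"
proof -
  let ?P = "(\<lambda>i::nat. [i] \<cdot> \<one>) ` {..<p}"
  have card: "card ?P = p" by (simp add: card_image add_pow_inj_on)
  have "x \<in> ?P"
  proof (rule fixed_points_of_power[OF fin, of ?P, unfolded card])
    show "y [^] p = y" if "y \<in> ?P" for y
      using that frobenius_add_pow[of \<one> 1] by auto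
  qed (use p_gt_1 x in auto)
  then show ?thesis using subring_add_pow_one[OF K] by blast
qed

text \<open>Irreducibility enters through three consequences: nonzero trace, degree
  \<open>p\<close>, and additive generation by the terms \<open>c \<beta>^i\<close>.\<close>

locale artin_schreier_tower = artin_schreier_root_field +
  assumes \<tau>_nonzero: "\<tau> \<noteq> \<zero>"
    and dim_L: "dimension p (emb ` carrier F) (carrier L)"
    and L_generated: "\<And>V. \<lbrakk> subgroup V (add_monoid L);
        \<And>c i. c \<in> carrier F \<Longrightarrow> emb c \<otimes> \<beta> [^] (i::nat) \<in> V \<rbrakk> \<Longrightarrow> carrier L \<subseteq> V"
begin

lemma subfield_emb: "subfield K F \<Longrightarrow> subfield (emb ` K) L"
  using emb.img_is_subfield(2) one_not_zero by blast

lemma card_emb: "K \<subseteq> carrier F \<Longrightarrow> card (emb ` K) = card K"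
  using card_image inj_on_subset[OF inj_emb] by blast

lemma L_card: "finite (carrier L)" "card (carrier L) = p ^ (N * p)"
  using dimension_card[OF subfield_emb[OF F.carrier_is_subfield] _ dim_L] card_emb[of "carrier F"] finite_F card_F
  by (simp_all add: power_mult)

lemma emb_nonzero: "a \<in> carrier F \<Longrightarrow> a \<noteq> \<zero>\<^bsub>F\<^esub> \<Longrightarrow> emb a \<noteq> \<zero>"
  using inj_onD[OF inj_emb, of a "\<zero>\<^bsub>F\<^esub>"] by auto

lemma \<alpha>_nonzero: "\<alpha> \<noteq> \<zero>\<^bsub>F\<^esub>"
proof
  assume "\<alpha> = \<zero>\<^bsub>F\<^esub>"
  then have "\<tau> = emb (\<Oplus>\<^bsub>F\<^esub>j\<in>{..<N}. \<zero>\<^bsub>F\<^esub>)"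
    unfolding \<tau>_def using p_gt_1 by (simp add: F.nat_pow_zero)
  then show False using \<tau>_nonzero by simp
qed

text \<open>Partial fractions at a shift \<open>y\<close> of \<beta> for which
  \<open>y^p - y\<close> is a constant \<open>c\<close> of \<open>F\<close>. The instances are the
  conjugates of \<beta> and \<open>y = \<beta> - 1\<close>.\<close>

lemma \<beta>_shift_pow:
  assumes "a \<in> carrier F" "y = \<beta> \<oplus> emb a" "y [^] p = y \<oplus> emb c" "c \<in> carrier F" "c \<noteq> \<zero>\<^bsub>F\<^esub>"
  shows "y \<in> carrier L" "y [^] p \<noteq> y" "y \<oplus> [(i::nat)] \<cdot> \<tau> \<noteq> \<zero>" "y \<oplus> [i] \<cdot> \<tau> \<in> carrier L"
    and "d < p \<Longrightarrow> emb c \<otimes> (\<Oplus>i\<in>{..<p}. ([i] \<cdot> \<tau>) [^] d \<otimes> inv (y \<oplus> [i] \<cdot> \<tau>)) = \<ominus> ((\<ominus> y) [^] d)"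
proof -
  show y: "y \<in> carrier L" unfolding assms(2) using assms(1) \<beta>_closed by simp
  have ec: "emb c \<noteq> \<zero>" "emb c \<in> carrier L" using emb_nonzero assms by auto
  show ne: "y [^] p \<noteq> y"
    using y ec add.l_cancel[of y "emb c" \<zero>] assms(3) by simp
  show "y \<oplus> [i] \<cdot> \<tau> \<noteq> \<zero>"
    using artin_schreier_shift_nonzero[OF \<tau>_closed \<tau>_pow_p y ne] .
  show "y \<oplus> [i] \<cdot> \<tau> \<in> carrier L" using y \<tau>_closed by simp
  have "y [^] p \<ominus> y = emb c"
    unfolding assms(3) using y ec(2) by algebra
  then show "emb c \<otimes> (\<Oplus>i\<in>{..<p}. ([i] \<cdot> \<tau>) [^] d \<otimes> inv (y \<oplus> [i] \<cdot> \<tau>)) = \<ominus> ((\<ominus> y) [^] d)" if "d < p"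
    using partial_fractions[OF \<tau>_closed \<tau>_pow_p \<tau>_nonzero y ne that] by simp
qed

text \<open>Raising \<open>\<beta>^p = \<beta> + \<alpha>\<close> to the power \<open>p^k\<close>
  gives the Artin-Schreier equation of the conjugate, with the conjugate of \<alpha> as its
  constant.\<close>

lemma \<beta>_pow_shift:
  obtains a where "a \<in> carrier F" "\<beta> [^] (p ^ k) = \<beta> \<oplus> emb a"
    "(\<beta> [^] (p ^ k)) [^] p = \<beta> [^] (p ^ k) \<oplus> emb (\<alpha> [^]\<^bsub>F\<^esub> (p ^ k))"
proof
  show "(\<Oplus>\<^bsub>F\<^esub>j\<in>{..<k}. \<alpha> [^]\<^bsub>F\<^esub> (p ^ j)) \<in> carrier F" using \<alpha>_closed by simp
  show "\<beta> [^] (p ^ k) = \<beta> \<oplus> emb (\<Oplus>\<^bsub>F\<^esub>j\<in>{..<k}. \<alpha> [^]\<^bsub>F\<^esub> (p ^ j))" by (rule \<beta>_pow)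
  have "(\<beta> [^] (p ^ k)) [^] p = (\<beta> [^] p) [^] (p ^ k)"
    using \<beta>_closed by (simp add: nat_pow_pow mult.commute)
  also have "\<dots> = \<beta> [^] (p ^ k) \<oplus> emb (\<alpha> [^]\<^bsub>F\<^esub> (p ^ k))"
    using \<beta>_closed \<alpha>_closed by (simp add: \<beta>_pow_p frobenius_pow_add emb.hom_nat_pow)
  finally show "(\<beta> [^] (p ^ k)) [^] p = \<beta> [^] (p ^ k) \<oplus> emb (\<alpha> [^]\<^bsub>F\<^esub> (p ^ k))" .
qed

lemma \<alpha>_pow: "\<alpha> [^]\<^bsub>F\<^esub> (n::nat) \<in> carrier F" "\<alpha> [^]\<^bsub>F\<^esub> n \<noteq> \<zero>\<^bsub>F\<^esub>"
  using \<alpha>_closed \<alpha>_nonzero F.nat_pow_nonzero by auto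

lemma \<beta>_nonzero: "\<beta> \<noteq> \<zero>"
  using \<beta>_shift_pow(3)[of "\<zero>\<^bsub>F\<^esub>" \<beta> \<alpha> 0] \<beta>_closed \<beta>_pow_p \<alpha>_closed \<alpha>_nonzero by simp

text \<open>This is the inverse of \<delta>, the generator of the normal bases.\<close>

definition \<theta> :: 'a where "\<theta> = inv \<beta> \<ominus> \<one>"

lemma \<theta>_closed: "\<theta> \<in> carrier L"
  unfolding \<theta>_def using inv_nonzero[OF \<beta>_closed \<beta>_nonzero] by simp

text \<open>The exponent acts in two stages: the power \<open>p^k\<close> moves \<beta> to a
  conjugate, then \<open>i\<close> rounds of the power \<open>p^N\<close> add
  \<open>i \<tau>\<close>.\<close>

lemma \<theta>_pow: "\<theta> [^] (p ^ (k + N * i)) = inv (\<beta> [^] (p ^ k) \<oplus> [i] \<cdot> \<tau>) \<ominus> \<one>"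
proof -
  obtain a where a: "a \<in> carrier F" "\<beta> [^] (p ^ k) = \<beta> \<oplus> emb a" using \<beta>_pow_shift by blast
  have "\<theta> [^] (p ^ (k + N * i)) = inv (\<beta> [^] (p ^ (k + N * i))) \<ominus> \<one>"
    unfolding \<theta>_def using inv_nonzero[OF \<beta>_closed \<beta>_nonzero]
    by (simp add: frobenius_pow_minus inv_nat_pow \<beta>_closed \<beta>_nonzero)
  also have "\<beta> [^] (p ^ (k + N * i)) = (\<beta> [^] (p ^ k)) [^] (p ^ (N * i))"
    using \<beta>_closed by (simp add: power_add nat_pow_pow)
  also have "\<dots> = \<beta> [^] (p ^ k) \<oplus> [i] \<cdot> \<tau>"
    unfolding a(2) using shift_pow_card[OF a(1)] .
  finally show ?thesis .
qed

text \<open>In the application \<open>p^e\<close> is the order of \<open>K\<close> and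
  \<open>M\<close> the degree of \<open>F\<close> over \<open>K\<close>. Partial fractions put
  conjugates of \<open>1/\<alpha>\<close> times powers of conjugates of \<beta> into
  \<open>V\<close>; the spanning hypothesis then frees the scalar, and induction on the exponent
  frees the power of \<beta>.\<close>

lemma subalgebra_containing_conjugates:
  assumes K: "subfield K F" and V: "subalgebra (emb ` K) V L"
    and span: "F.Span K (map (\<lambda>k. inv\<^bsub>F\<^esub> \<alpha> [^]\<^bsub>F\<^esub> (p ^ (e * k))) [0..<M]) = carrier F"
    and conj: "\<And>k i. \<lbrakk> k < M; i < p \<rbrakk> \<Longrightarrow> \<theta> [^] (p ^ (e * k + N * i)) \<in> V"
  shows "carrier L \<subseteq> V"
proof -
  note v = subalgebra_closed[OF V]
  have K': "subring (emb ` K) L" using subfieldE(1)[OF subfield_emb[OF K]] .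
  note k' = subringE[OF K']
  note K_F = subfieldE(3)[OF K]
  define a where "a = (\<lambda>k. inv\<^bsub>F\<^esub> \<alpha> [^]\<^bsub>F\<^esub> (p ^ (e * k)))"
  have a: "a k \<in> carrier F" "emb (a k) = inv (emb (\<alpha> [^]\<^bsub>F\<^esub> (p ^ (e * k))))" for k
    unfolding a_def using F.hom_inv[OF emb.ring_hom_ring_axioms field_axioms \<alpha>_pow] F.inv_nonzero[OF \<alpha>_closed \<alpha>_nonzero]
    by (simp_all add: F.inv_nat_pow[symmetric] \<alpha>_closed \<alpha>_nonzero)
  \<comment> \<open>The weights \<open>(i \<tau>)^d\<close> come from the prime field, hence from
    the image of \<open>K\<close>, so weighted sums of conjugates stay in \<open>V\<close>.\<close>
  have power_closed: "x [^] (d::nat) \<in> emb ` K" if "x \<in> emb ` K" for x d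
    by (induction d) (use that k' in simp_all)
  have "\<tau> \<in> emb ` K" using prime_subfield_mem[OF L_card(1) \<tau>_closed \<tau>_pow_p K'] .
  have "[i] \<cdot> \<tau> \<in> emb ` K" for i :: nat
    by (induction i) (use k' \<open>\<tau> \<in> emb ` K\<close> in simp_all)
  then have coef: "([i] \<cdot> \<tau>) [^] d \<in> emb ` K" for i d :: nat using power_closed by blast

  \<comment> \<open>A conjugate of \<theta> differs from \<open>1/(y + i \<tau>)\<close> by 1, so
    the power sum of the weights appears as a correction that must lie in \<open>V\<close>. It is 0
    for \<open>d < p - 1\<close>, in particular for \<open>d = 0\<close>; for
    \<open>d = p - 1\<close> it is -1, which awaits the proof that 1 is in \<open>V\<close>.\<close>
  have y_power: "emb (a k) \<otimes> (\<beta> [^] (p ^ (e * k))) [^] d \<in> V"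
    if k: "k < M" and d: "d < p" and sum: "(\<Oplus>i\<in>{..<p}. ([i] \<cdot> \<tau>) [^] d) \<in> V" for k d
  proof -
    let ?y = "\<beta> [^] (p ^ (e * k))" and ?c = "\<alpha> [^]\<^bsub>F\<^esub> (p ^ (e * k))"
    let ?u = "\<lambda>i. inv (?y \<oplus> [i] \<cdot> \<tau>)"
    let ?z = "\<Oplus>i\<in>{..<p}. ([i] \<cdot> \<tau>) [^] d \<otimes> ?u i"
    obtain b where b: "b \<in> carrier F" "?y = \<beta> \<oplus> emb b" "?y [^] p = ?y \<oplus> emb ?c"
      using \<beta>_pow_shift by blast
    note y = \<beta>_shift_pow[OF b \<alpha>_pow]
    have u: "?u i \<in> carrier L" for i :: nat using inv_nonzero(1)[OF y(4) y(3)] .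
    have t: "([i] \<cdot> \<tau>) [^] d \<in> carrier L" for i :: nat using \<tau>_closed by simp
    have "?z = (\<Oplus>i\<in>{..<p}. ([i] \<cdot> \<tau>) [^] d \<otimes> \<theta> [^] (p ^ (e * k + N * i)) \<oplus> ([i] \<cdot> \<tau>) [^] d)"
    proof (rule finsum_cong')
      fix i
      have "s \<otimes> w = s \<otimes> (w \<ominus> \<one>) \<oplus> s" if "s \<in> carrier L" "w \<in> carrier L" for s w
        using that by algebra
      from this[OF t u] show "([i] \<cdot> \<tau>) [^] d \<otimes> ?u i =
          ([i] \<cdot> \<tau>) [^] d \<otimes> \<theta> [^] (p ^ (e * k + N * i)) \<oplus> ([i] \<cdot> \<tau>) [^] d"
        unfolding \<theta>_pow .
    qed (use t \<theta>_closed in auto)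
    also have "\<dots> = (\<Oplus>i\<in>{..<p}. ([i] \<cdot> \<tau>) [^] d \<otimes> \<theta> [^] (p ^ (e * k + N * i))) \<oplus> (\<Oplus>i\<in>{..<p}. ([i] \<cdot> \<tau>) [^] d)"
      using t \<theta>_closed by (intro finsum_addf) auto
    also have "\<dots> \<in> V"
      by (rule v(3)[OF v(7) sum], rule v(6)[OF coef conj[OF k]]) simp
    finally have z: "?z \<in> V" .
    have zL: "?z \<in> carrier L" using z v(1) by auto
    have ec: "emb ?c \<in> carrier L" "emb ?c \<noteq> \<zero>" using \<alpha>_pow emb_nonzero by auto
    note ic = inv_nonzero[OF ec]
    have yd: "?y [^] d = (\<ominus> \<one>) [^] d \<otimes> (\<ominus> ?y) [^] d"
    proof -
      have "?y = \<ominus> \<one> \<otimes> \<ominus> ?y" using y(1) by (simp add: l_minus)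
      then show ?thesis using y(1) nat_pow_distrib[of "\<ominus> \<one>" "\<ominus> ?y" d] by simp
    qed
    have "(\<ominus> ?y) [^] d = \<ominus> (emb ?c \<otimes> ?z)" using y(5)[OF d] y(1) by simp
    then have "emb (a k) \<otimes> ?y [^] d = inv (emb ?c) \<otimes> ((\<ominus> \<one>) [^] d \<otimes> \<ominus> (emb ?c \<otimes> ?z))"
      unfolding yd a(2) by simp
    also have "\<dots> = (\<ominus> \<one>) [^] d \<otimes> \<ominus> ?z"
    proof -
      have "w \<otimes> (s \<otimes> \<ominus> (c \<otimes> z)) = (w \<otimes> c) \<otimes> (s \<otimes> \<ominus> z)"
        if "w \<in> carrier L" "s \<in> carrier L" "c \<in> carrier L" "z \<in> carrier L" for w s c z
        using that by algebra
      from this[OF ic(1) _ ec(1) zL, of "(\<ominus> \<one>) [^] d"] ic(3) zL show ?thesis by simp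
    qed
    also have "\<dots> \<in> V" using z v(4,6) power_closed k'(3,5) by simp
    finally show ?thesis .
  qed

  \<comment> \<open>The scalars \<open>x\<close> with \<open>x w\<close> in \<open>V\<close> form a
    \<open>K\<close>-subspace of \<open>F\<close>; containing a spanning list, it is all of
    \<open>F\<close>.\<close>
  have F_closed: "emb x \<otimes> w \<in> V"
    if w: "w \<in> carrier L" "\<And>k. k < M \<Longrightarrow> emb (a k) \<otimes> w \<in> V" and x: "x \<in> carrier F" for w x
  proof -
    let ?W = "{x \<in> carrier F. emb x \<otimes> w \<in> V}"
    have "subgroup ?W (add_monoid F)"
    proof (rule F.add.subgroupI)
      show "?W \<noteq> {}" using v(2) w(1) by (auto intro!: exI[of _ "\<zero>\<^bsub>F\<^esub>"])
    qed (use w(1) v(3,4) in \<open>auto simp: l_distr l_minus a_inv_def[symmetric]\<close>)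
    then have "subalgebra K ?W F"
      using w(1) v(6) K_F by (auto simp: subalgebra_def subalgebra_axioms_def m_assoc subset_iff)
    moreover have "set (map a [0..<M]) \<subseteq> ?W" using w(2) a(1) by auto
    ultimately have "F.Span K (map a [0..<M]) \<subseteq> ?W" by (rule F.subalgebra_Span_incl[OF K])
    then have "carrier F \<subseteq> ?W" using span unfolding a_def by simp
    then show ?thesis using x by blast
  qed

  \<comment> \<open>The case \<open>d = 0\<close>: it provides the constants, hence the correction
    term for \<open>d = p - 1\<close>.\<close>
  have emb_V: "emb x \<in> V" if x: "x \<in> carrier F" for x
  proof -
    have "emb (a k) \<otimes> \<one> \<in> V" if "k < M" for k
      using y_power[OF that, of 0] power_sum_zero[OF \<tau>_closed, of 0] p_gt_1 v(2) by simp
    from F_closed[OF one_closed this x] show ?thesis using x by simp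
  qed
  have sum: "(\<Oplus>i\<in>{..<p}. ([i] \<cdot> \<tau>) [^] d) \<in> V" if "d < p" for d :: nat
  proof (cases "d = p - 1")
    case True
    then show ?thesis using power_sum_minus_one[OF \<tau>_closed \<tau>_pow_p \<tau>_nonzero] emb_V[of "\<one>\<^bsub>F\<^esub>"] v(4) by simp
  next
    case False
    then show ?thesis using power_sum_zero[OF \<tau>_closed, of d] that v(2) by simp
  qed

  have \<beta>_power: "emb x \<otimes> \<beta> [^] d \<in> V" if "x \<in> carrier F" for x and d :: nat
    using that
  proof (induction d arbitrary: x rule: less_induct)
    case (less d)
    note IH = less.IH
    show ?case
    proof (cases "d < p")
      case True
      \<comment> \<open>The expansion of \<open>(\<beta> + b)^d\<close> is triangular: apart from
        \<open>\<beta>^d\<close> it consists of \<open>F\<close>-multiples of lower powers, which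
        are in \<open>V\<close> by induction.\<close>
      have "emb (a k) \<otimes> \<beta> [^] d \<in> V" if k: "k < M" for k
      proof -
        obtain b where b: "b \<in> carrier F" "\<beta> [^] (p ^ (e * k)) = \<beta> \<oplus> emb b" using \<beta>_pow_shift by blast
        let ?t = "\<lambda>j. [(d choose j)] \<cdot> (\<beta> [^] j \<otimes> emb b [^] (d - j))"
        have t: "?t j \<in> carrier L" for j using b(1) \<beta>_closed by simp
        have "emb (a k) \<otimes> (\<beta> [^] (p ^ (e * k))) [^] d = emb (a k) \<otimes> (\<Oplus>j\<in>{..d}. ?t j)"
          unfolding b(2) using binomial[of \<beta> "emb b" d] \<beta>_closed b(1) by simp
        also have "(\<Oplus>j\<in>{..d}. ?t j) = \<beta> [^] d \<oplus> (\<Oplus>j\<in>{..<d}. ?t j)"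
          using t \<beta>_closed by (simp add: lessThan_Suc_atMost[symmetric] lessThan_Suc)
        also have "emb (a k) \<otimes> \<dots> = emb (a k) \<otimes> \<beta> [^] d \<oplus> (\<Oplus>j\<in>{..<d}. emb (a k) \<otimes> ?t j)"
          using a(1)[of k] t \<beta>_closed by (simp add: r_distr finsum_rdistr Pi_iff)
        finally have eq: "emb (a k) \<otimes> (\<beta> [^] (p ^ (e * k))) [^] d =
          emb (a k) \<otimes> \<beta> [^] d \<oplus> (\<Oplus>j\<in>{..<d}. emb (a k) \<otimes> ?t j)" .
        have r: "(\<Oplus>j\<in>{..<d}. emb (a k) \<otimes> ?t j) \<in> V"
        proof (rule v(7))
          fix j assume "j \<in> {..<d}"
          then have j: "j < d" by simp
          have "emb (a k) \<otimes> ?t j = [(d choose j)] \<cdot> (emb (a k \<otimes>\<^bsub>F\<^esub> b [^]\<^bsub>F\<^esub> (d - j)) \<otimes> \<beta> [^] j)"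
            using a(1)[of k] b(1) \<beta>_closed by (simp add: add_pow_rdistr emb.hom_nat_pow m_ac)
          also have "\<dots> \<in> V" using a(1) b(1) by (intro v(8) IH[OF j]) simp
          finally show "emb (a k) \<otimes> ?t j \<in> V" .
        qed
        have "x' = (x' \<oplus> r) \<ominus> r" if "x' \<in> carrier L" "r \<in> carrier L" for x' r using that by algebra
        from this[of "emb (a k) \<otimes> \<beta> [^] d", OF _ subsetD[OF v(1) r]] 
        show ?thesis
          using v(5)[OF y_power[OF k True sum[OF True]] r] a(1)[of k] \<beta>_closed unfolding eq by simp
      qed
      then show ?thesis using F_closed[of "\<beta> [^] d" x] less.prems \<beta>_closed by simp
    next
      case False
      \<comment> \<open>One factor \<open>\<beta>^p\<close> is replaced by
        \<open>\<beta> + \<alpha>\<close>; the new exponents \<open>d - p + 1\<close> and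
        \<open>d - p\<close> are below \<open>d\<close> because \<open>p > 1\<close>.\<close>
      then have d: "d = (d - p) + p" by simp
      have "\<beta> [^] d = \<beta> [^] (d - p) \<otimes> (\<beta> \<oplus> emb \<alpha>)"
        using \<beta>_closed nat_pow_mult[of \<beta> "d - p" p] \<beta>_pow_p d by simp
      then have "emb x \<otimes> \<beta> [^] d = emb x \<otimes> \<beta> [^] Suc (d - p) \<oplus> emb (x \<otimes>\<^bsub>F\<^esub> \<alpha>) \<otimes> \<beta> [^] (d - p)"
        using less.prems \<beta>_closed \<alpha>_closed by (simp add: r_distr l_distr m_ac)
      then show ?thesis
        using IH[of "Suc (d - p)" x] IH[of "d - p" "x \<otimes>\<^bsub>F\<^esub> \<alpha>"] False p_gt_1 less.prems \<alpha>_closed v(3) by simp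
    qed
  qed
  show ?thesis
    using L_generated[of V] V \<beta>_power by (auto simp: subalgebra_def)
qed

end

section \<open>Normal bases of the extension\<close>

lemma (in ring) combine_map_distinct:
  assumes "distinct xs" "g \<in> set xs \<rightarrow> carrier R" "f \<in> set xs \<rightarrow> carrier R"
  shows "combine (map g xs) (map f xs) = (\<Oplus>x\<in>set xs. g x \<otimes> f x)"
  using assms by (induction xs) (auto simp: Pi_iff)

text \<open>In degree one the only conjugate is \<open>x\<close> itself. This lets the base
  \<open>F\<close> be treated together with the prime field.\<close>

lemma (in field) normal_element_self:
  assumes "finite (carrier R)" "x \<in> carrier R" "x \<noteq> \<zero>"
  shows "normal_element R (carrier R) x"
proof -
  note K = carrier_is_subfield
  have conj: "conjugates R (carrier R) x = [x]"
    using dimI[OF K dimension_one[OF K]] assms(2) by (simp add: conjugates_def)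
  have ind: "independent (carrier R) [x]"
    using assms by (intro li_Cons) auto
  have "Span (carrier R) [x] = carrier R"
    using independent_length_eq_dimension[OF K dimension_one[OF K] ind] assms(2) by simp
  then show ?thesis
    unfolding normal_element_def conj using ind K assms field_axioms by simp
qed

context artin_schreier_tower begin

text \<open>The number of conjugates of \<theta> is the degree of \<open>L\<close> over the image of
  \<open>K\<close>, so it is enough that they span.\<close>

theorem normal_element_extension:
  assumes nrm: "normal_element F K (inv\<^bsub>F\<^esub> \<alpha>)"
  shows "normal_element L (emb ` K) \<theta>" and "(dim over (emb ` K)) (carrier L) = (F.dim over K) (carrier F) * p"
proof -
  have K: "subfield K F" and ind: "F.independent K (conjugates F K (inv\<^bsub>F\<^esub> \<alpha>))"
    and span: "F.Span K (conjugates F K (inv\<^bsub>F\<^esub> \<alpha>)) = carrier F"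
    using nrm by (simp_all add: normal_element_def)
  define M where "M = (F.dim over K) (carrier F)"
  define r where "r = card K"
  have conj_F: "conjugates F K (inv\<^bsub>F\<^esub> \<alpha>) = map (\<lambda>i. inv\<^bsub>F\<^esub> \<alpha> [^]\<^bsub>F\<^esub> (r ^ i)) [0..<M]"
    by (simp add: conjugates_def M_def r_def)
  have dim_F: "F.dimension M K (carrier F)"
    using F.dimensionI[OF K ind span] conj_F by simp
  have finK: "finite K" using finite_subset[OF subfieldE(3)[OF K] finite_F] .
  have rM: "r ^ M = p ^ N"
    using F.dimension_card[OF K finK dim_F] card_F by (simp add: r_def)
  have "card {\<zero>\<^bsub>F\<^esub>, \<one>\<^bsub>F\<^esub>} \<le> card (carrier F)" using finite_F by (intro card_mono) auto
  then have "p ^ N > 1" using card_F by simp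
  \<comment> \<open>A positive \<open>M\<close> makes \<open>r\<close> a divisor of
    \<open>p^N\<close>, hence a power \<open>p^e\<close>; comparing sizes gives
    \<open>N = e M\<close>.\<close>
  then have M0: "M > 0" using rM by (cases M) auto
  then have "r dvd p ^ N" using rM by (metis dvd_power)
  then obtain e where e: "r = p ^ e" using divides_primepow_nat[OF prime_p] by blast
  have N: "N = e * M" using rM p_gt_1 unfolding e by (simp add: power_mult[symmetric])
  note subfield_L = subfield_emb[OF K] 
  have dim_KF: "dimension M (emb ` K) (emb ` carrier F)"
    using emb.inj_hom_dimension[OF K one_not_zero inj_emb dim_F] .
  have dim_KL: "dimension (M * p) (emb ` K) (carrier L)"
    using telescopic_base[OF subfield_L subfield_emb[OF F.carrier_is_subfield] dim_KF dim_L] .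
  show "(dim over (emb ` K)) (carrier L) = (F.dim over K) (carrier F) * p"
    using dimI[OF subfield_L dim_KL] by (simp add: M_def)
  have conj_L: "conjugates L (emb ` K) \<theta> = map (\<lambda>j. \<theta> [^] (p ^ (e * j))) [0..<M * p]"
    using dimI[OF subfield_L dim_KL] card_emb[OF subfieldE(3)[OF K]] 
    by (simp add: conjugates_def r_def[symmetric] e power_mult)
  let ?Us = "conjugates L (emb ` K) \<theta>"
  have Us: "set ?Us \<subseteq> carrier L" unfolding conj_L using \<theta>_closed by auto
  have V: "subalgebra (emb ` K) (Span (emb ` K) ?Us) L"
    using Span_is_subalgebra[OF subfield_L Us] .
  have "carrier L \<subseteq> Span (emb ` K) ?Us"
  proof (rule subalgebra_containing_conjugates[OF K V])
    show "F.Span K (map (\<lambda>k. inv\<^bsub>F\<^esub> \<alpha> [^]\<^bsub>F\<^esub> (p ^ (e * k))) [0..<M]) = carrier F"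
      using span unfolding conj_F e by (simp add: power_mult)
    \<comment> \<open>The exponent \<open>e k + N i\<close> is \<open>e (k + M i)\<close>, and
      \<open>k + M i\<close> is a conjugate index below \<open>M p\<close>.\<close>
    fix k i assume ki: "k < M" "i < p"
    then have "k + M * i < M * p"
      by (metis add_less_mono1 less_le_trans mult_Suc_right mult_le_mono2 Suc_leI)
    then have "\<theta> [^] (p ^ (e * (k + M * i))) \<in> set ?Us" unfolding conj_L by auto
    then show "\<theta> [^] (p ^ (e * k + N * i)) \<in> Span (emb ` K) ?Us"
      using Span_base_incl[OF subfield_L Us] unfolding N by (auto simp: distrib_left mult.assoc)
  qed
  then have span_L: "Span (emb ` K) ?Us = carrier L"
    using subalgebra_closed(1)[OF V] by blast
  have "independent (emb ` K) ?Us"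
    using spanning_list_independent[OF subfield_L _ Us] dim_KL span_L by (simp add: conj_L)
  then show "normal_element L (emb ` K) \<theta>"
    unfolding normal_element_def using span_L subfield_L L_card(1) \<theta>_closed field_axioms by simp
qed

text \<open>The trace is the combination of the conjugates with all coefficients 1, which
  independence keeps from vanishing. From \<open>card K = p\<close> the number of conjugates is
  \<open>N\<close>.\<close>

lemma normal_imp_trace_nonzero:
  assumes nrm: "normal_element F K x" and K: "card K = p" and x: "x \<in> carrier F"
  shows "(\<Oplus>\<^bsub>F\<^esub>j\<in>{..<N}. x [^]\<^bsub>F\<^esub> (p ^ j)) \<noteq> \<zero>\<^bsub>F\<^esub>"
proof
  assume 0: "(\<Oplus>\<^bsub>F\<^esub>j\<in>{..<N}. x [^]\<^bsub>F\<^esub> (p ^ j)) = \<zero>\<^bsub>F\<^esub>"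
  have sub: "subfield K F" and ind: "F.independent K (conjugates F K x)"
    and span: "F.Span K (conjugates F K x) = carrier F"
    using nrm by (simp_all add: normal_element_def)
  define M where "M = (F.dim over K) (carrier F)"
  have conj_F: "conjugates F K x = map (\<lambda>i. x [^]\<^bsub>F\<^esub> (p ^ i)) [0..<M]"
    by (simp add: conjugates_def M_def K)
  have dim_F: "F.dimension M K (carrier F)"
    using F.dimensionI[OF sub ind span] conj_F by simp
  have finK: "finite K" using finite_subset[OF subfieldE(3)[OF sub] finite_F] .
  have "p ^ M = p ^ N"
    using F.dimension_card[OF sub finK dim_F] card_F by (simp add: K)
  then have MN: "M = N" using p_gt_1 by simp
  have "card {\<zero>\<^bsub>F\<^esub>, \<one>\<^bsub>F\<^esub>} \<le> card (carrier F)" using finite_F by (intro card_mono) auto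
  then have N0: "N > 0" using card_F by (cases N) auto
  have "F.combine (map (\<lambda>_. \<one>\<^bsub>F\<^esub>) [0..<N]) (conjugates F K x) = (\<Oplus>\<^bsub>F\<^esub>j\<in>{..<N}. \<one>\<^bsub>F\<^esub> \<otimes>\<^bsub>F\<^esub> x [^]\<^bsub>F\<^esub> (p ^ j))"
    unfolding conj_F MN using x by (subst F.combine_map_distinct) (auto simp: lessThan_atLeast0)
  also have "\<dots> = \<zero>\<^bsub>F\<^esub>" using 0 x by simp
  finally have "set (take (length (conjugates F K x)) (map (\<lambda>_. \<one>\<^bsub>F\<^esub>) [0..<N])) \<subseteq> {\<zero>\<^bsub>F\<^esub>}"
    using subringE(3)[OF subfieldE(1)[OF sub]]
    by (intro F.independent_imp_trivial_combine[OF sub ind]) auto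
  moreover have "\<one>\<^bsub>F\<^esub> \<in> (\<lambda>_. \<one>\<^bsub>F\<^esub>) ` {0..<N}" using N0 by (intro image_eqI[of _ _ 0]) auto
  ultimately have "\<one>\<^bsub>F\<^esub> = \<zero>\<^bsub>F\<^esub>" unfolding conj_F MN by (simp del: F.one_not_zero) blast
  then show False by simp
qed

section \<open>The trace of \<delta>\<close>

definition \<delta> :: 'a where "\<delta> = inv \<theta>"

text \<open>From \<open>\<delta> = \<beta>/(1 - \<beta>) = -1 - 1/(\<beta> - 1)\<close>, the partial
  fraction identity at \<open>y = \<beta> - 1\<close> becomes applicable to \<delta>.\<close>

lemma \<delta>_eq: "\<theta> \<noteq> \<zero>" "\<delta> = \<ominus> \<one> \<ominus> inv (\<beta> \<ominus> \<one>)" "\<delta> \<in> carrier L" "\<beta> \<ominus> \<one> \<noteq> \<zero>"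
proof -
  note \<beta> = inv_nonzero[OF \<beta>_closed \<beta>_nonzero]
  show "\<beta> \<ominus> \<one> \<noteq> \<zero>"
  proof
    assume "\<beta> \<ominus> \<one> = \<zero>"
    then have "\<beta> = \<one>" using \<beta>_closed by simp
    then have "\<one> \<oplus> emb \<alpha> = \<one> \<oplus> \<zero>" using \<beta>_pow_p by simp
    then show False using emb_nonzero[OF \<alpha>_closed \<alpha>_nonzero] \<alpha>_closed by simp
  qed
  then have 1: "\<beta> \<ominus> \<one> \<in> carrier L" "\<beta> \<ominus> \<one> \<noteq> \<zero>" using \<beta>_closed by auto
  note \<beta>1 = inv_nonzero[OF 1]
  define u where "u = inv \<beta>"
  define v where "v = inv (\<beta> \<ominus> \<one>)"
  have u: "u \<in> carrier L" "u \<otimes> \<beta> = \<one>" and v: "v \<in> carrier L" "v \<otimes> (\<beta> \<ominus> \<one>) = \<one>"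
    using \<beta> \<beta>1 by (simp_all add: u_def v_def)
  \<comment> \<open>The inverses satisfy \<open>v - u = u v\<close>, as their denominators differ by
    1.\<close>
  have "v = v \<otimes> (u \<otimes> \<beta>)" using u v by simp
  also have "\<dots> = u \<otimes> (v \<otimes> (\<beta> \<ominus> \<one>)) \<oplus> u \<otimes> v" using u(1) v(1) \<beta>_closed by algebra
  also have "\<dots> = u \<oplus> u \<otimes> v" using u v by simp
  finally have uv: "v = u \<oplus> u \<otimes> v" .
  have "(u \<ominus> \<one>) \<otimes> (\<ominus> \<one> \<ominus> v) = \<one> \<oplus> v \<ominus> (u \<oplus> u \<otimes> v)" using u(1) v(1) by algebra
  also have "\<dots> = \<one>" using uv v(1) by algebra
  finally have prod: "\<theta> \<otimes> (\<ominus> \<one> \<ominus> v) = \<one>" unfolding \<theta>_def u_def .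
  then show \<theta>: "\<theta> \<noteq> \<zero>" using v(1) by auto
  show "\<delta> = \<ominus> \<one> \<ominus> inv (\<beta> \<ominus> \<one>)"
    unfolding \<delta>_def v_def[symmetric] using inv_eqI[OF \<theta>_closed _ prod] v(1) by simp
  show "\<delta> \<in> carrier L" unfolding \<delta>_def using inv_nonzero[OF \<theta>_closed \<theta>] by simp
qed

text \<open>The constants -1 add up to \<open>-p = 0\<close>, and the inverses of the shifts of
  \<open>\<beta> - 1\<close> add up to \<open>-1/\<alpha>\<close> by partial fractions with
  \<open>d = 0\<close>.\<close>

lemma \<delta>_relative_trace: "(\<Oplus>i\<in>{..<p}. \<delta> [^] (p ^ (N * i))) = emb (inv\<^bsub>F\<^esub> \<alpha>)"
proof -
  have m1: "\<ominus>\<^bsub>F\<^esub> \<one>\<^bsub>F\<^esub> \<in> carrier F" by simp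
  have y: "\<beta> \<ominus> \<one> = \<beta> \<oplus> emb (\<ominus>\<^bsub>F\<^esub> \<one>\<^bsub>F\<^esub>)" by (simp add: minus_eq)
  have "(\<beta> \<ominus> \<one>) [^] p = \<beta> \<oplus> emb \<alpha> \<ominus> \<one>"
    using frobenius_pow_minus[of \<beta> \<one> 1] \<beta>_closed \<beta>_pow_p by simp
  also have "\<dots> = (\<beta> \<ominus> \<one>) \<oplus> emb \<alpha>" using \<beta>_closed \<alpha>_closed emb.hom_closed by algebra
  finally have yp: "(\<beta> \<ominus> \<one>) [^] p = (\<beta> \<ominus> \<one>) \<oplus> emb \<alpha>" .
  note s = \<beta>_shift_pow[OF m1 y yp \<alpha>_closed \<alpha>_nonzero]
  let ?u = "\<lambda>i. inv (\<beta> \<ominus> \<one> \<oplus> [i] \<cdot> \<tau>)"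
  have u: "?u i \<in> carrier L" for i :: nat using inv_nonzero(1)[OF s(4) s(3)] .
  note i1 = inv_nonzero[OF s(1) \<delta>_eq(4)]
  have "\<delta> [^] (p ^ (N * i)) = \<ominus> \<one> \<oplus> \<ominus> \<one> \<otimes> ?u i" for i
  proof -
    have "\<delta> [^] (p ^ (N * i)) = (\<ominus> \<one>) [^] (p ^ (N * i)) \<ominus> inv ((\<beta> \<ominus> \<one>) [^] (p ^ (N * i)))"
      unfolding \<delta>_eq(2) using i1(1) by (simp add: frobenius_pow_minus inv_nat_pow[OF s(1) \<delta>_eq(4)])
    also have "(\<ominus> \<one>) [^] (p ^ (N * i)) = \<ominus> \<one>" by (simp add: frobenius_pow_neg)
    also have "(\<beta> \<ominus> \<one>) [^] (p ^ (N * i)) = \<beta> \<ominus> \<one> \<oplus> [i] \<cdot> \<tau>"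
      unfolding y using shift_pow_card[OF m1] .
    finally show ?thesis using u[of i] by (simp add: minus_eq l_minus)
  qed
  then have "(\<Oplus>i\<in>{..<p}. \<delta> [^] (p ^ (N * i))) = (\<Oplus>i\<in>{..<p}. \<ominus> \<one> \<oplus> \<ominus> \<one> \<otimes> ?u i)" by simp
  also have "\<dots> = (\<Oplus>i\<in>{..<p}. \<ominus> \<one>) \<oplus> \<ominus> \<one> \<otimes> (\<Oplus>i\<in>{..<p}. ?u i)"
    using u by (subst finsum_addf) (auto simp: finsum_rdistr)
  also have "(\<Oplus>i\<in>{..<p}. \<ominus> \<one>) = \<zero>"
    using add.finprod_const[of "\<ominus> \<one>" "{..<p}"] add_pow_dvd[of "\<ominus> \<one>" p] by simp
  finally have T: "(\<Oplus>i\<in>{..<p}. \<delta> [^] (p ^ (N * i))) = \<ominus> (\<Oplus>i\<in>{..<p}. ?u i)"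
    using u by (simp add: l_minus)
  have "emb \<alpha> \<otimes> (\<Oplus>i\<in>{..<p}. ?u i) = \<ominus> \<one>" using s(5)[of 0] u p_gt_1 by simp
  then have "emb \<alpha> \<otimes> \<ominus> (\<Oplus>i\<in>{..<p}. ?u i) = \<one>" using u \<alpha>_closed by (simp add: r_minus)
  then have "inv (emb \<alpha>) = \<ominus> (\<Oplus>i\<in>{..<p}. ?u i)" using u \<alpha>_closed by (intro inv_eqI) auto
  then show ?thesis using T F.hom_inv[OF emb.ring_hom_ring_axioms field_axioms \<alpha>_closed \<alpha>_nonzero] by simp
qed

text \<open>Transitivity of the trace: the exponents \<open>j < N p\<close> are split as
  \<open>k + N i\<close>, and the sum over \<open>i\<close> is the trace down to
  \<open>F\<close>.\<close>

lemma \<delta>_trace: "(\<Oplus>j\<in>{..<N * p}. \<delta> [^] (p ^ j)) = emb (\<Oplus>\<^bsub>F\<^esub>j\<in>{..<N}. (inv\<^bsub>F\<^esub> \<alpha>) [^]\<^bsub>F\<^esub> (p ^ j))"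
proof -
  define T where "T = (\<lambda>x. \<Oplus>k\<in>{..<N}. x [^] (p ^ k))"
  have T: "T x \<in> carrier L" if "x \<in> carrier L" for x unfolding T_def using that by simp
  have T_add: "T (x \<oplus> y) = T x \<oplus> T y" if "x \<in> carrier L" "y \<in> carrier L" for x y
    unfolding T_def using that by (simp add: frobenius_pow_add)
  have d: "\<delta> [^] n \<in> carrier L" for n :: nat using \<delta>_eq(3) by simp
  have "(\<Oplus>j\<in>{..<N * m}. \<delta> [^] (p ^ j)) = T (\<Oplus>i\<in>{..<m}. \<delta> [^] (p ^ (N * i)))" for m
  proof (induction m)
    case 0
    have "T \<zero> = (\<Oplus>k\<in>{..<N}. \<zero>)" unfolding T_def using p_gt_1 by (simp add: nat_pow_zero)
    then show ?case by simp
  next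
    case (Suc m)
    have split: "{..<N * Suc m} = {..<N * m} \<union> (\<lambda>k. k + N * m) ` {..<N}"
    proof -
      have "x \<in> (\<lambda>k. k + N * m) ` {..<N}" if "x < N * Suc m" "\<not> x < N * m" for x
        using that by (intro image_eqI[of _ _ "x - N * m"]) auto
      then have "{..<N * Suc m} \<subseteq> {..<N * m} \<union> (\<lambda>k. k + N * m) ` {..<N}" by (meson UnCI lessThan_iff subsetI)
      then show ?thesis by auto
    qed
    have "(\<Oplus>j\<in>{..<N * Suc m}. \<delta> [^] (p ^ j)) =
        (\<Oplus>j\<in>{..<N * m}. \<delta> [^] (p ^ j)) \<oplus> (\<Oplus>j\<in>(\<lambda>k. k + N * m) ` {..<N}. \<delta> [^] (p ^ j))"
      unfolding split using d by (intro finsum_Un_disjoint) auto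
    also have "(\<Oplus>j\<in>(\<lambda>k. k + N * m) ` {..<N}. \<delta> [^] (p ^ j)) = (\<Oplus>k\<in>{..<N}. \<delta> [^] (p ^ (k + N * m)))"
      using d by (intro finsum_reindex) (auto simp: inj_on_def)
    also have "\<dots> = T (\<delta> [^] (p ^ (N * m)))"
      unfolding T_def using \<delta>_eq(3) by (simp add: nat_pow_pow power_add mult.commute)
    also have "(\<Oplus>j\<in>{..<N * m}. \<delta> [^] (p ^ j)) \<oplus> \<dots> = T (\<Oplus>i\<in>{..<Suc m}. \<delta> [^] (p ^ (N * i)))"
      unfolding Suc using d by (subst T_add[symmetric]) (auto simp: lessThan_Suc a_comm)
    finally show ?case .
  qed
  from this[of p] have "(\<Oplus>j\<in>{..<N * p}. \<delta> [^] (p ^ j)) = T (emb (inv\<^bsub>F\<^esub> \<alpha>))"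
    unfolding \<delta>_relative_trace .
  also have "\<dots> = emb (\<Oplus>\<^bsub>F\<^esub>j\<in>{..<N}. (inv\<^bsub>F\<^esub> \<alpha>) [^]\<^bsub>F\<^esub> (p ^ j))"
    unfolding T_def using F.inv_nonzero[OF \<alpha>_closed \<alpha>_nonzero] by (simp add: emb.hom_nat_pow comp_def)
  finally show ?thesis .
qed

text \<open>The trace criterion over \<open>L\<close>: the absolute trace of \<delta> is that of
  \<open>1/\<alpha>\<close>, nonzero by normality over the prime field.\<close>

theorem artin_schreier_\<delta>_irreducible:
  assumes "normal_element F K (inv\<^bsub>F\<^esub> \<alpha>)" "card K = p"
  shows "pirreducible (carrier L) (artin_schreier_poly L p \<delta>)"
proof (rule trace_nonzero_imp_artin_schreier_irreducible[OF L_card \<delta>_eq(3)])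
  show "(\<Oplus>j\<in>{..<N * p}. \<delta> [^] (p ^ j)) \<noteq> \<zero>"
    unfolding \<delta>_trace using F.inv_nonzero[OF \<alpha>_closed \<alpha>_nonzero] normal_imp_trace_nonzero[OF assms]
    by (intro emb_nonzero F.finsum_closed) auto
qed

section \<open>The multiplication table\<close>

lemma shifted_inverse_product:
  assumes "a \<in> carrier L" "b \<in> carrier L" "a \<noteq> \<zero>" "b \<noteq> \<zero>" "c \<in> carrier L" "c \<noteq> \<zero>" "b = a \<oplus> c"
  shows "(inv a \<ominus> \<one>) \<otimes> (inv b \<ominus> \<one>) =
    (inv c \<ominus> \<one>) \<otimes> (inv a \<ominus> \<one>) \<ominus> (inv c \<oplus> \<one>) \<otimes> (inv b \<ominus> \<one>) \<ominus> \<one>"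
proof -
  define u v w where "u = inv a" "v = inv b" "w = inv c"
  have u: "u \<in> carrier L" "u \<otimes> a = \<one>" and v: "v \<in> carrier L" "v \<otimes> b = \<one>" and w: "w \<in> carrier L" "w \<otimes> c = \<one>"
    using assms inv_nonzero by (auto simp: u_v_w_def)
  \<comment> \<open>Since \<open>b - a = c\<close>, the product \<open>1/(a b)\<close> is
    \<open>(1/c)(1/a - 1/b)\<close>; the rest accounts for the subtracted ones.\<close>
  have "w \<otimes> (u \<ominus> v) = w \<otimes> (u \<otimes> (v \<otimes> b) \<ominus> v \<otimes> (u \<otimes> a))" using u v by simp
  also have "\<dots> = (w \<otimes> c) \<otimes> (u \<otimes> v)" unfolding assms(7) using u(1) v(1) w(1) assms(1,5) by algebra
  finally have uv: "w \<otimes> (u \<ominus> v) = u \<otimes> v" using u v w by simp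
  have "(u \<ominus> \<one>) \<otimes> (v \<ominus> \<one>) = u \<otimes> v \<ominus> u \<ominus> v \<oplus> \<one>" using u(1) v(1) by algebra
  also have "\<dots> = w \<otimes> (u \<ominus> v) \<ominus> u \<ominus> v \<oplus> \<one>" unfolding uv ..
  also have "\<dots> = (w \<ominus> \<one>) \<otimes> (u \<ominus> \<one>) \<ominus> (w \<oplus> \<one>) \<otimes> (v \<ominus> \<one>) \<ominus> \<one>" using u(1) v(1) w(1) by algebra
  finally show ?thesis unfolding u_v_w_def .
qed

lemma \<theta>_conjugate: "\<theta> [^] (p ^ (N * i)) = inv (\<beta> \<oplus> [i] \<cdot> \<tau>) \<ominus> \<one>"
  using \<theta>_pow[of 0 i] \<beta>_closed by simp

lemma \<beta>_plus: "\<beta> \<oplus> [(i::nat)] \<cdot> \<tau> \<in> carrier L" "\<beta> \<oplus> [i] \<cdot> \<tau> \<noteq> \<zero>"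
  using \<beta>_shift_pow(3,4)[of "\<zero>\<^bsub>F\<^esub>" \<beta> \<alpha> i] \<beta>_closed \<beta>_pow_p \<alpha>_closed \<alpha>_nonzero by simp_all

text \<open>The denominators of the two conjugates differ by \<open>c = (j - i) \<tau>\<close>, a
  nonzero element of the prime field; the coefficients therefore lie there too.\<close>

theorem conjugate_product:
  assumes "i < p" "j < p" "i \<noteq> j"
  defines "c \<equiv> [j] \<cdot> \<tau> \<ominus> [i] \<cdot> \<tau>"
  shows "c \<noteq> \<zero>"
    and "\<theta> [^] (p ^ (N * i)) \<otimes> \<theta> [^] (p ^ (N * j)) =
      (inv c \<ominus> \<one>) \<otimes> \<theta> [^] (p ^ (N * i)) \<ominus> (inv c \<oplus> \<one>) \<otimes> \<theta> [^] (p ^ (N * j)) \<ominus> \<one>"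
proof -
  have c: "c \<in> carrier L" unfolding c_def using \<tau>_closed by simp
  show c0: "c \<noteq> \<zero>"
  proof
    assume "c = \<zero>"
    then have "[j] \<cdot> \<tau> = [i] \<cdot> \<tau>" unfolding c_def using \<tau>_closed by simp
    from inj_onD[OF add_pow_inj_on[OF \<tau>_closed \<tau>_nonzero] this] show False
      using assms(1-3) by simp
  qed
  have "x \<oplus> y = (x \<oplus> z) \<oplus> (y \<ominus> z)" if "x \<in> carrier L" "y \<in> carrier L" "z \<in> carrier L" for x y z
    using that by algebra
  from this[of \<beta> "[j] \<cdot> \<tau>" "[i] \<cdot> \<tau>"] have "\<beta> \<oplus> [j] \<cdot> \<tau> = (\<beta> \<oplus> [i] \<cdot> \<tau>) \<oplus> c"
    unfolding c_def by (rule) (use \<beta>_closed \<tau>_closed in simp_all)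
  from shifted_inverse_product[OF \<beta>_plus(1) \<beta>_plus(1) \<beta>_plus(2) \<beta>_plus(2) c c0 this]
  show "\<theta> [^] (p ^ (N * i)) \<otimes> \<theta> [^] (p ^ (N * j)) =
      (inv c \<ominus> \<one>) \<otimes> \<theta> [^] (p ^ (N * i)) \<ominus> (inv c \<oplus> \<one>) \<otimes> \<theta> [^] (p ^ (N * j)) \<ominus> \<one>"
    unfolding \<theta>_conjugate .
qed

lemma conjugates_\<theta>: "conjugates L (emb ` carrier F) \<theta> = map (\<lambda>i. \<theta> [^] (p ^ (N * i))) [0..<p]"
  and normal_element_\<theta>: "normal_element L (emb ` carrier F) \<theta>"
proof -
  have "normal_element F (carrier F) (inv\<^bsub>F\<^esub> \<alpha>)"
    using F.normal_element_self[OF finite_F] F.inv_nonzero[OF \<alpha>_closed \<alpha>_nonzero] by blast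
  note nrm = normal_element_extension[OF this]
  show "normal_element L (emb ` carrier F) \<theta>" by (rule nrm(1))
  have "(F.dim over carrier F) (carrier F) = 1"
    using F.dimI[OF F.carrier_is_subfield F.dimension_one[OF F.carrier_is_subfield]] .
  then show "conjugates L (emb ` carrier F) \<theta> = map (\<lambda>i. \<theta> [^] (p ^ (N * i))) [0..<p]"
    using nrm(2) card_emb[of "carrier F"] card_F by (simp add: conjugates_def power_mult)
qed

text \<open>Every subfield \<open>k\<close> contains the prime field, where the coefficients of
  products of distinct conjugates lie. Squares are expanded in the normal basis over
  \<open>F\<close>.\<close>

theorem nearly_optimal_\<theta>:
  assumes k: "subfield k F"
  shows "nearly_optimal L (emb ` carrier F) (emb ` k) (conjugates L (emb ` carrier F) \<theta>)"
proof -
  define f where "f = (\<lambda>i. \<theta> [^] (p ^ (N * i)))"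
  define Us where "Us = map f [0..<p]"
  have f: "f i \<in> carrier L" for i unfolding f_def using \<theta>_closed by simp
  have Us: "conjugates L (emb ` carrier F) \<theta> = Us" "length Us = p" "set Us \<subseteq> carrier L"
    unfolding conjugates_\<theta> Us_def f_def using \<theta>_closed by auto
  have nth: "i < p \<Longrightarrow> Us ! i = f i" for i by (simp add: Us_def)
  note sub = subfield_emb[OF k] and subF = subfield_emb[OF F.carrier_is_subfield]
  note k' = subringE[OF subfieldE(1)[OF sub]]
  have kF: "emb ` k \<subseteq> emb ` carrier F" using subfieldE(3)[OF k] by blast
  \<comment> \<open>\<open>P i j t\<close> gathers all requirements on a single entry
    \<open>t\<close> of the table, so that the entries can be chosen independently.\<close>
  define P where "P = (\<lambda>i j t. length t = Suc p \<and> set t \<subseteq> emb ` carrier F \<and> f i \<otimes> f j = combine t (Us @ [\<one>]) \<and>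
    (i \<noteq> j \<longrightarrow> set t \<subseteq> emb ` k \<and> (\<forall>l < p. l \<noteq> i \<longrightarrow> l \<noteq> j \<longrightarrow> t ! l = \<zero>)))"
  have ex: "\<exists>t. P i j t" if ij: "i < p" "j < p" for i j
  proof (cases "i = j")
    case True
    have "f i \<otimes> f j \<in> Span (emb ` carrier F) Us"
      using normal_element_\<theta> f Us(1) by (simp add: normal_element_def)
    then obtain t where t: "set t \<subseteq> emb ` carrier F" "length t = length Us" "f i \<otimes> f j = combine t Us"
      using Span_mem_iff_length_version[OF subF Us(3)] by blast
    have "set t \<subseteq> carrier L" using t(1) subfieldE(3)[OF subF] by blast
    \<comment> \<open>For a square the extra element 1 receives coefficient 0.\<close>
    then have "combine (t @ [\<zero>]) (Us @ [\<one>]) = combine t Us"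
      using combine_append[OF t(2) _ Us(3), of "[\<zero>]" "[\<one>]"] Us(3) by simp
    then have "P i j (t @ [\<zero>])"
      unfolding P_def using t Us(2) True subringE(2)[OF subfieldE(1)[OF subF]] by simp
    then show ?thesis ..
  next
    case False
    define c where "c = [j] \<cdot> \<tau> \<ominus> [i] \<cdot> \<tau>"
    have c0: "c \<noteq> \<zero>"
      and prod: "f i \<otimes> f j = (inv c \<ominus> \<one>) \<otimes> f i \<ominus> (inv c \<oplus> \<one>) \<otimes> f j \<ominus> \<one>"
      using conjugate_product[OF ij False] unfolding f_def c_def by blast+
    have "\<tau> \<in> emb ` k"
      using prime_subfield_mem[OF L_card(1) \<tau>_closed \<tau>_pow_p subfieldE(1)[OF sub]] .
    then have "[l] \<cdot> \<tau> \<in> emb ` k" for l :: nat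
      by (induction l) (use k' in simp_all)
    then have "c \<in> emb ` k - {\<zero>}" using k' c0 by (simp add: c_def minus_eq)
    then have w: "inv c \<in> emb ` k" using subfield_m_inv(1)[OF sub] by blast
    \<comment> \<open>The coefficients are read off from the product formula; position
      \<open>p\<close> of the extended list holds the extra 1.\<close>
    define g where "g = (\<lambda>l. if l = i then inv c \<ominus> \<one> else if l = j then \<ominus> (inv c \<oplus> \<one>)
      else if l = p then \<ominus> \<one> else \<zero>)"
    have g: "g l \<in> emb ` k" for l
      unfolding g_def minus_eq using w k' by simp
    then have gL: "g l \<in> carrier L" for l using k'(1) by blast
    have wL: "inv c \<in> carrier L" using w k'(1) by blast
    define f' where "f' = (\<lambda>l. if l = p then \<one> else f l)"
    have f': "f' l \<in> carrier L" for l unfolding f'_def using f by simp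
    have UsE: "Us @ [\<one>] = map f' [0..<Suc p]" by (auto simp: Us_def f'_def)
    have "combine (map g [0..<Suc p]) (Us @ [\<one>]) = (\<Oplus>l\<in>{..<Suc p}. g l \<otimes> f' l)"
      unfolding UsE using gL f' by (subst combine_map_distinct) (auto simp: lessThan_atLeast0 simp del: upt_Suc)
    also have "\<dots> = (\<Oplus>l\<in>{i, j, p}. g l \<otimes> f' l)"
      using ij gL f' by (intro add.finprod_mono_neutral_cong_right) (auto simp: g_def)
    also have "\<dots> = (inv c \<ominus> \<one>) \<otimes> f i \<oplus> (\<ominus> (inv c \<oplus> \<one>) \<otimes> f j \<oplus> \<ominus> \<one>)"
      using ij False gL f' f wL by (simp add: g_def f'_def)
    also have "\<dots> = f i \<otimes> f j"
      unfolding prod using wL f[of i] f[of j] by algebra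
    finally have "f i \<otimes> f j = combine (map g [0..<Suc p]) (Us @ [\<one>])" ..
    moreover have "set (map g [0..<Suc p]) \<subseteq> emb ` k" using g by auto
    moreover from this have "set (map g [0..<Suc p]) \<subseteq> emb ` carrier F" using kF by (rule subset_trans)
    moreover have "\<forall>l<p. l \<noteq> i \<longrightarrow> l \<noteq> j \<longrightarrow> map g [0..<Suc p] ! l = \<zero>"
    proof (intro allI impI)
      fix l assume l: "l < p" "l \<noteq> i" "l \<noteq> j"
      have "map g [0..<Suc p] ! l = g l" using l(1) by (simp del: upt_Suc)
      then show "map g [0..<Suc p] ! l = \<zero>" using l by (simp add: g_def)
    qed
    moreover have "length (map g [0..<Suc p]) = Suc p" by simp
    ultimately have "P i j (map g [0..<Suc p])"
      unfolding P_def by (intro conjI impI)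
    then show ?thesis ..
  qed
  define T where "T = (\<lambda>i j. SOME t. P i j t)"
  have T: "P i j (T i j)" if "i < p" "j < p" for i j
    unfolding T_def by (rule someI_ex) (rule ex[OF that])
  have "length (T i j) = Suc p \<and> set (T i j) \<subseteq> emb ` carrier F \<and> Us ! i \<otimes> Us ! j = combine (T i j) (Us @ [\<one>])"
    if "i < p" "j < p" for i j
    using T[OF that] unfolding P_def nth[OF that(1)] nth[OF that(2)] by (elim conjE) (intro conjI)
  then have "ext_mult_table L (emb ` carrier F) Us T"
    unfolding ext_mult_table_def Us(2) by blast
  moreover have "set (T i j) \<subseteq> emb ` k \<and> (\<forall>l<p. l \<noteq> i \<longrightarrow> l \<noteq> j \<longrightarrow> T i j ! l = \<zero>)"
    if "i < p" "j < p" "i \<noteq> j" for i j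
    using T[OF that(1,2)] that(3) unfolding P_def by (elim conjE) (rule mp)
  ultimately show ?thesis
    unfolding nearly_optimal_def Us(1,2) by (intro exI[of _ T] conjI allI impI) auto
qed

end

section \<open>The prime field as an image of the residue ring, and the concrete extension\<close>

lemma residue_ring_hom_char:
  assumes p: "p > 1" and F: "field F" and \<iota>: "\<iota> \<in> ring_hom (residue_ring (int p)) F"
  shows "[p] \<cdot>\<^bsub>F\<^esub> \<one>\<^bsub>F\<^esub> = \<zero>\<^bsub>F\<^esub>"
    and "\<iota> ` carrier (residue_ring (int p)) = (\<lambda>i::nat. [i] \<cdot>\<^bsub>F\<^esub> \<one>\<^bsub>F\<^esub>) ` {..<p}"
proof -
  interpret F: field F by fact
  have add: "\<iota> ((a + b) mod int p) = \<iota> a \<oplus>\<^bsub>F\<^esub> \<iota> b" and closed: "\<iota> a \<in> carrier F"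
    if "a \<in> {0..<int p}" "b \<in> {0..<int p}" for a b
    using ring_hom_add[OF \<iota>, of a b] ring_hom_closed[OF \<iota>, of a] that
    by (auto simp: residue_ring_def)
  have one: "\<iota> 1 = \<one>\<^bsub>F\<^esub>" using ring_hom_one[OF \<iota>] by (simp add: residue_ring_def)
  \<comment> \<open>Zero is preserved because its image is idempotent for addition and can be
    cancelled.\<close>
  have "\<iota> 0 \<oplus>\<^bsub>F\<^esub> \<iota> 0 = \<iota> 0 \<oplus>\<^bsub>F\<^esub> \<zero>\<^bsub>F\<^esub>" using add[of 0 0] closed[of 0 0] p by simp
  then have zero: "\<iota> 0 = \<zero>\<^bsub>F\<^esub>"
    using closed[of 0 0] p by (metis F.add.l_cancel F.zero_closed atLeastLessThan_iff of_nat_0_less_iff order_refl less_trans zero_less_one)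
  have \<iota>_eq: "\<iota> (int i) = [i] \<cdot>\<^bsub>F\<^esub> \<one>\<^bsub>F\<^esub>" if "i < p" for i
    using that
  proof (induction i)
    case (Suc i)
    then show ?case using add[of "int i" 1] one p by (simp add: add.commute)
  qed (use zero in simp)
  \<comment> \<open>The value at \<open>p\<close> is out of range for \<open>\<iota>_eq\<close>; the
    last step from \<open>p - 1\<close> wraps around to 0.\<close>
  have "[p] \<cdot>\<^bsub>F\<^esub> \<one>\<^bsub>F\<^esub> = [(p - 1)] \<cdot>\<^bsub>F\<^esub> \<one>\<^bsub>F\<^esub> \<oplus>\<^bsub>F\<^esub> \<one>\<^bsub>F\<^esub>"
    using F.add.nat_pow_Suc[of "p - 1" "\<one>\<^bsub>F\<^esub>"] p by (simp only: Suc_diff_1)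
  also have "\<dots> = \<iota> (int (p - 1)) \<oplus>\<^bsub>F\<^esub> \<iota> 1" using \<iota>_eq[of "p - 1"] p one by simp
  also have "\<dots> = \<iota> ((int (p - 1) + 1) mod int p)" using add[of "int (p - 1)" 1] p by simp
  also have "(int (p - 1) + 1) mod int p = 0" using p by simp
  finally show "[p] \<cdot>\<^bsub>F\<^esub> \<one>\<^bsub>F\<^esub> = \<zero>\<^bsub>F\<^esub>" using zero by simp
  have "carrier (residue_ring (int p)) = int ` {..<p}"
    by (auto simp: residue_ring_def image_iff intro!: bexI[of _ "nat _"])
  then show "\<iota> ` carrier (residue_ring (int p)) = (\<lambda>i::nat. [i] \<cdot>\<^bsub>F\<^esub> \<one>\<^bsub>F\<^esub>) ` {..<p}"
    using \<iota>_eq by (simp add: image_image)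
qed

text \<open>The trace criterion gives the nonzero trace; the degree and the generating terms come
  from the rupture construction.\<close>

lemma (in prime_char_field) artin_schreier_ext_tower:
  assumes fin: "finite (carrier R)" "card (carrier R) = p ^ N" and a: "a \<in> carrier R"
    and irr: "pirreducible (carrier R) (artin_schreier_poly R p a)"
  shows "artin_schreier_tower (artin_schreier_ext R p a) p R (artin_schreier_embed R p a) N a (artin_schreier_root R p a)"
proof -
  let ?f = "artin_schreier_poly R p a"
  let ?emb = "\<lambda>c. rupture_surj (carrier R) ?f (poly_of_const c)"
  note f = artin_schreier_poly_closed[OF a p_gt_1]
  interpret UP: domain "poly_ring R" using univ_poly_is_domain[OF carrier_is_subring] .
  have "?f pdivides ?f" using f(1) by (simp add: pdivides_def)
  note r = rupture_artin_schreier_root_field(1)[OF f(1) irr this fin a]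
  note e = rupture_embedding[OF f(1) irr]
  interpret A: artin_schreier_root_field "Rupt (carrier R) ?f" p R ?emb N a "rupture_surj (carrier R) ?f X"
    by (rule r)
  have eqs: "artin_schreier_ext R p a = Rupt (carrier R) ?f" "artin_schreier_embed R p a = ?emb"
    "artin_schreier_root R p a = rupture_surj (carrier R) ?f X"
    by (simp_all only: artin_schreier_ext_def artin_schreier_root_def artin_schreier_embed_def fun_eq_iff simp_thms)
  show ?thesis
    unfolding eqs
  proof (intro artin_schreier_tower.intro artin_schreier_tower_axioms.intro r)
    show "A.\<tau> \<noteq> \<zero>\<^bsub>Rupt (carrier R) ?f\<^esub>"
    proof
      let ?t = "\<Oplus>j\<in>{..<N}. a [^] (p ^ j)"
      assume "A.\<tau> = \<zero>\<^bsub>Rupt (carrier R) ?f\<^esub>"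
      then have "?emb ?t = ?emb \<zero>" unfolding A.\<tau>_def using A.emb.hom_zero by (rule trans[OF _ sym])
      moreover have "?t \<in> carrier R" using a by (intro finsum_closed) simp
      ultimately have "?t = \<zero>" using inj_onD[OF A.inj_emb] zero_closed by blast
      then show False using artin_schreier_irreducible_imp_trace_nonzero[OF fin a irr] by contradiction
    qed
    show "ring.dimension (Rupt (carrier R) ?f) p (?emb ` carrier R) (carrier (Rupt (carrier R) ?f))"
      using e(4) unfolding f(2) .
    show "carrier (Rupt (carrier R) ?f) \<subseteq> V"
      if "subgroup V (add_monoid (Rupt (carrier R) ?f))"
        "\<And>c i. c \<in> carrier R \<Longrightarrow> ?emb c \<otimes>\<^bsub>Rupt (carrier R) ?f\<^esub>
          rupture_surj (carrier R) ?f X [^]\<^bsub>Rupt (carrier R) ?f\<^esub> (i::nat) \<in> V" for V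
      by (rule e(6)[OF that])
  qed
qed

theorem mainTheorem4:
  fixes F :: "('a, 'b) ring_scheme"
    and p m n :: nat
    and \<iota> :: "int \<Rightarrow> 'a"
    and Zp E :: "'a set"
    and \<alpha> h :: 'a
    and L :: "('a list set) ring"
    and emb :: "'a \<Rightarrow> 'a list set"
    and \<beta> \<delta> :: "'a list set"
  assumes "prime p" and "m > 0" and "n > 0"
    and "field F"
    and "\<iota> \<in> ring_hom (residue_ring (int p)) F"
    and "Zp = \<iota> ` carrier (residue_ring (int p))"
    and "ring.dimension F (m * n) Zp (carrier F)"
    and "subfield E F" and "card E = p ^ m"
    and "\<alpha> \<in> carrier F" and "\<alpha> \<noteq> \<zero>\<^bsub>F\<^esub>"
    and "pirreducible\<^bsub>F\<^esub> (carrier F) (artin_schreier_poly F p \<alpha>)"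
    and "normal_element F E (inv\<^bsub>F\<^esub> \<alpha>)"
    and "normal_element F Zp (inv\<^bsub>F\<^esub> \<alpha>)"
    and "L = artin_schreier_ext F p \<alpha>"
    and "emb = artin_schreier_embed F p \<alpha>"
    and "\<beta> = artin_schreier_root F p \<alpha>"
    and "\<delta> = inv\<^bsub>L\<^esub> (inv\<^bsub>L\<^esub> \<beta> \<ominus>\<^bsub>L\<^esub> \<one>\<^bsub>L\<^esub>)"
    and "h = (\<Oplus>\<^bsub>F\<^esub>j\<in>{..<m * n}. \<alpha> [^]\<^bsub>F\<^esub> (p ^ j))"
  shows "\<beta> \<in> Units L \<and> \<delta> \<in> Units L \<and> inv\<^bsub>L\<^esub> \<delta> = inv\<^bsub>L\<^esub> \<beta> \<ominus>\<^bsub>L\<^esub> \<one>\<^bsub>L\<^esub> \<and>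
    normal_element L (emb ` carrier F) (inv\<^bsub>L\<^esub> \<delta>) \<and>
    normal_element L (emb ` Zp) (inv\<^bsub>L\<^esub> \<delta>) \<and>
    pirreducible\<^bsub>L\<^esub> (carrier L) (artin_schreier_poly L p \<delta>) \<and>
    nearly_optimal L (emb ` carrier F) (emb ` Zp) (conjugates L (emb ` carrier F) (inv\<^bsub>L\<^esub> \<delta>)) \<and>
    h \<in> Zp - {\<zero>\<^bsub>F\<^esub>} \<and>
    (\<forall>i\<in>{1..p - 1}.
       inv\<^bsub>L\<^esub> \<delta> [^]\<^bsub>L\<^esub> (1 + p ^ (i * (m * n))) =
         (inv\<^bsub>L\<^esub> ([i] \<cdot>\<^bsub>L\<^esub> emb h) \<ominus>\<^bsub>L\<^esub> \<one>\<^bsub>L\<^esub>) \<otimes>\<^bsub>L\<^esub> inv\<^bsub>L\<^esub> \<delta>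
         \<ominus>\<^bsub>L\<^esub> (inv\<^bsub>L\<^esub> ([i] \<cdot>\<^bsub>L\<^esub> emb h) \<oplus>\<^bsub>L\<^esub> \<one>\<^bsub>L\<^esub>)
             \<otimes>\<^bsub>L\<^esub> (inv\<^bsub>L\<^esub> \<delta> [^]\<^bsub>L\<^esub> (p ^ (i * (m * n))))
         \<ominus>\<^bsub>L\<^esub> \<one>\<^bsub>L\<^esub>)"
proof -
  define N where "N = m * n"
  have p: "p > 1" using assms(1) prime_gt_1_nat by blast
  interpret F: field F by fact
  note char = residue_ring_hom_char[OF p assms(4,5)]
  interpret F: prime_char_field F p
    by unfold_locales (use assms(1) char(1) in auto)
  have Zp: "subfield Zp F" using assms(14) by (simp add: normal_element_def)
  have card_Zp: "card Zp = p"
    unfolding assms(6) char(2) using F.add_pow_inj_on[OF F.one_closed F.one_not_zero] by (simp add: card_image)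
  then have "finite Zp" using p card_ge_0_finite by force
  then have fin: "finite (carrier F)" "card (carrier F) = p ^ N"
    using F.dimension_card[OF Zp _ assms(7)] card_Zp by (simp_all add: N_def)
  have tower: "artin_schreier_tower L p F emb N \<alpha> \<beta>"
    unfolding assms(15-17) using F.artin_schreier_ext_tower[OF fin assms(10,12)] .
  interpret A: artin_schreier_tower L p F emb N \<alpha> \<beta> by (rule tower)
  have \<delta>: "\<delta> = A.\<delta>" unfolding A.\<delta>_def A.\<theta>_def assms(18) ..
  have inv_\<delta>: "inv\<^bsub>L\<^esub> \<delta> = A.\<theta>"
    unfolding \<delta> A.\<delta>_def
    using A.inv_eqI[OF _ A.\<theta>_closed] A.inv_nonzero[OF A.\<theta>_closed A.\<delta>_eq(1)] by blast
  have Units: "\<beta> \<in> Units L" "\<delta> \<in> Units L"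
    using A.\<beta>_closed A.\<beta>_nonzero A.inv_nonzero[OF A.\<theta>_closed A.\<delta>_eq(1)]
    unfolding \<delta> A.\<delta>_def A.field_Units by auto
  have h_closed: "h \<in> carrier F" unfolding assms(19) using assms(10) by (intro F.finsum_closed) simp
  have "h = (\<Oplus>\<^bsub>F\<^esub>j\<in>{..<N}. \<alpha> [^]\<^bsub>F\<^esub> (p ^ j))" unfolding assms(19) N_def ..
  then have emb_h: "emb h = A.\<tau>" by (simp only: A.\<tau>_def)
  \<comment> \<open>Injectivity carries the Frobenius invariance of \<tau> back to \<open>h\<close>,
    which places \<open>h\<close> in \<open>Zp\<close>.\<close>
  have "emb (h [^]\<^bsub>F\<^esub> p) = emb h"
    using A.\<tau>_pow_p h_closed unfolding emb_h[symmetric] by (simp add: A.emb.hom_nat_pow)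
  then have "h [^]\<^bsub>F\<^esub> p = h" using inj_onD[OF A.inj_emb] h_closed by simp
  then have "h \<in> Zp" using F.prime_subfield_mem[OF fin(1) h_closed _ subfieldE(1)[OF Zp]] by blast
  moreover have "h \<noteq> \<zero>\<^bsub>F\<^esub>" using A.\<tau>_nonzero unfolding emb_h[symmetric] by auto
  ultimately have h: "h \<in> Zp - {\<zero>\<^bsub>F\<^esub>}" by blast
  have prod: "A.\<theta> [^]\<^bsub>L\<^esub> (1 + p ^ (i * (m * n))) =
         (inv\<^bsub>L\<^esub> ([i] \<cdot>\<^bsub>L\<^esub> emb h) \<ominus>\<^bsub>L\<^esub> \<one>\<^bsub>L\<^esub>) \<otimes>\<^bsub>L\<^esub> A.\<theta>
         \<ominus>\<^bsub>L\<^esub> (inv\<^bsub>L\<^esub> ([i] \<cdot>\<^bsub>L\<^esub> emb h) \<oplus>\<^bsub>L\<^esub> \<one>\<^bsub>L\<^esub>)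
             \<otimes>\<^bsub>L\<^esub> (A.\<theta> [^]\<^bsub>L\<^esub> (p ^ (i * (m * n))))
         \<ominus>\<^bsub>L\<^esub> \<one>\<^bsub>L\<^esub>" if i: "i \<in> {1..p - 1}" for i
  proof -
    \<comment> \<open>The formula is the product of the conjugates with indices 0 and
      \<open>i\<close>, whose shifts differ by \<open>i \<tau>\<close>.\<close>
    have e: "i * (m * n) = N * i" unfolding N_def by simp
    have i': "0 < p" "i < p" "0 \<noteq> i" using i p by auto
    have c: "[i] \<cdot>\<^bsub>L\<^esub> A.\<tau> \<ominus>\<^bsub>L\<^esub> [(0::nat)] \<cdot>\<^bsub>L\<^esub> A.\<tau> = [i] \<cdot>\<^bsub>L\<^esub> A.\<tau>"
      using A.\<tau>_closed by (simp add: A.minus_eq)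
    have t: "A.\<theta> [^]\<^bsub>L\<^esub> (p ^ (N * 0)) = A.\<theta>" using A.\<theta>_closed by simp
    have "A.\<theta> [^]\<^bsub>L\<^esub> (1 + p ^ (N * i)) = A.\<theta> \<otimes>\<^bsub>L\<^esub> A.\<theta> [^]\<^bsub>L\<^esub> (p ^ (N * i))"
      using A.\<theta>_closed A.nat_pow_mult[of A.\<theta> 1 "p ^ (N * i)"] by simp
    then show ?thesis
      using A.conjugate_product(2)[OF i'] unfolding c t e emb_h by simp
  qed
  show ?thesis
    unfolding inv_\<delta>
  proof (intro conjI ballI Units h prod)
    show "A.\<theta> = inv\<^bsub>L\<^esub> \<beta> \<ominus>\<^bsub>L\<^esub> \<one>\<^bsub>L\<^esub>" by (rule A.\<theta>_def)
    show "normal_element L (emb ` carrier F) A.\<theta>" by (rule A.normal_element_\<theta>)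
    show "normal_element L (emb ` Zp) A.\<theta>" by (rule A.normal_element_extension(1)[OF assms(14)])
    show "pirreducible\<^bsub>L\<^esub> (carrier L) (artin_schreier_poly L p \<delta>)"
      unfolding \<delta> by (rule A.artin_schreier_\<delta>_irreducible[OF assms(14) card_Zp])
    show "nearly_optimal L (emb ` carrier F) (emb ` Zp) (conjugates L (emb ` carrier F) A.\<theta>)"
      by (rule A.nearly_optimal_\<theta>[OF Zp])
  qed
qed

end
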